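(* Let $\mathcal{C}$ be an abelian tensor category satisfying Condition C (defined in the context), and let $A,B\in\mathcal{C}^b$. Then $[A,B]=B\otimes A^*$ (as an internal Hom from $A$ to $B$) and, with the morphisms $m$, $\eta$, $\varepsilon$ defined in the context, (i) $B\otimes A^*$ is non-zero; (ii) the morphism $\eta_A:\mathbf{1}\to[A,A]$ is injective; (iii) the pairing $\varepsilon_A\circ m_{A,B,A}:[B,A]\otimes[A,B]\to\mathbf{1}^*$ is non-degenerate.
   Context: A tensor category is a (not necessarily strict) monoidal category $(\mathcal{C},\otimes,\mathbf{1},\alpha,\lambda,\rho)$ with tensor unit $\mathbf{1}$, associator $\alpha_{U,V,W}:U\otimes(V\otimes W)\to(U\otimes V)\otimes W$ and unit isomorphisms $\lambda_U:\mathbf{1}\otimes U\to U$, $\rho_U:U\otimes\mathbf{1}\to U$. An abelian tensor category is a tensor category whose underlying category is abelian. "Injective" means monomorphism. Condition C: $\mathcal{C}$ is equipped with a contravariant involutive functor $(-)^*:\mathcal{C}\to\mathcal{C}$, i.e. there is a natural isomorphism $\delta_U:U\to U^{**}$, and with isomorphisms $\pi_{U,V}:\mathrm{Hom}(U,V^* )\to\mathrm{Hom}(U\otimes V,\mathbf{1}^* )$ natural in $U$ and $V$. A morphism $p:U\otimes V\to\mathbf{1}^*$ is called non-degenerate if $\pi_{U,V}^{-1}(p):U\to V^*$ is an isomorphism. Right dual of $U$: an object $U^\vee$ with morphisms $b_U:\mathbf{1}\to U\otimes U^\vee$, $d_U:U^\vee\otimes U\to\mathbf{1}$ such that $\rho_U\circ(\mathrm{id}_U\otimes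 d_U)\circ\alpha^{-1}_{U,U^\vee,U}\circ(b_U\otimes\mathrm{id}_U)\circ\lambda_U^{-1}=\mathrm{id}_U$ and $\lambda_{U^\vee}\circ(d_U\otimes\mathrm{id}_{U^\vee})\circ\alpha_{U^\vee,U,U^\vee}\circ(\mathrm{id}_{U^\vee}\otimes b_U)\circ\rho^{-1}_{U^\vee}=\mathrm{id}_{U^\vee}$. Left dual of $U$: an object ${}^\vee U$ with morphisms $\tilde b_U:\mathbf{1}\to{}^\vee U\otimes U$, $\tilde d_U:U\otimes{}^\vee U\to\mathbf{1}$ satisfying the analogous two identities. $\mathcal{C}^b$ is the subcategory of $\mathcal{C}$ consisting of all objects $U$ for which $U^*$ is both a right dual and a left dual of $U$, and for which both $b_U:\mathbf{1}\to U\otimes U^*$ and $\tilde b_U:\mathbf{1}\to U^*\otimes U$ are injective. For each $U\in\mathcal{C}^b$ such duality morphisms are fixed. An internal Hom from $A$ to $B$ is an object $[A,B]$ with an isomorphism $\phi^{(A,B)}_X:\mathrm{Hom}(X\otimes A,B)\to\mathrm{Hom}(X,[A,B])$ natural in $X$. For $A,B\in\mathcal{C}^b$ one takes $[A,B]=B\otimes A^*$ with $\phi^{(A,B)}_X(f)=(f\otimes\mathrm{id}_{A^*})\circ\alpha_{X,A,A^*}\circ(\mathrm{id}_X\otimes b_A)\circ\rho_X^{-1}$. Multiplication, unit and one-point morphisms are (suppressing associators and unit isomorphisms), for $A,B,C\in\mathcal{C}^b$: $m_{C,B,A}=\mathrm{id}_C\otimes d_B\otimes\mathrm{id}_{A^*}:(C\otimes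 B^* )\otimes(B\otimes A^* )\to C\otimes A^*$, $\eta_A=b_A:\mathbf{1}\to A\otimes A^*$, $\varepsilon_A=\pi_{A,A^*}(\delta_A):A\otimes A^*\to\mathbf{1}^*$.
   Formalization: Part (i) is stated for categories having at least one non-zero object; in the category with only a zero object, all hypotheses hold but B⊗A* is zero, so (i) fails there. *)

theory Defs
  imports "HOL-Algebra.Group"
begin

section \<open>Categories\<close>

record ('o, 'm) cat_data =
  Obj :: "'o set"
  Mor :: "'m set"
  Dom :: "'m \<Rightarrow> 'o"
  Cod :: "'m \<Rightarrow> 'o"
  Id :: "'o \<Rightarrow> 'm"
  Comp :: "'m \<Rightarrow> 'm \<Rightarrow> 'm"  (infixr \<open>\<cdot>\<index>\<close> 55)

definition Hom :: "('o, 'm, 'x) cat_data_scheme \<Rightarrow> 'o \<Rightarrow> 'o \<Rightarrow> 'm set" where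
  "Hom C X Y = {f \<in> Mor C. Dom C f = X \<and> Cod C f = Y}"

locale category =
  fixes C :: "('o, 'm, 'x) cat_data_scheme" (structure)
  assumes Dom_Obj: "f \<in> Mor C \<Longrightarrow> Dom C f \<in> Obj C"
    and Cod_Obj: "f \<in> Mor C \<Longrightarrow> Cod C f \<in> Obj C"
    and Id_Hom: "X \<in> Obj C \<Longrightarrow> Id C X \<in> Hom C X X"
    and Comp_Hom: "\<lbrakk>f \<in> Hom C X Y; g \<in> Hom C Y Z\<rbrakk> \<Longrightarrow> g \<cdot> f \<in> Hom C X Z"
    and Id_left: "f \<in> Hom C X Y \<Longrightarrow> Id C Y \<cdot> f = f"
    and Id_right: "f \<in> Hom C X Y \<Longrightarrow> f \<cdot> Id C X = f"
    and Comp_assoc: "\<lbrakk>f \<in> Hom C W X; g \<in> Hom C X Y; h \<in> Hom C Y Z\<rbrakk>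
          \<Longrightarrow> (h \<cdot> g) \<cdot> f = h \<cdot> (g \<cdot> f)"

definition inverse_mor :: "('o, 'm, 'x) cat_data_scheme \<Rightarrow> 'm \<Rightarrow> 'm \<Rightarrow> bool" where
  "inverse_mor C f g \<longleftrightarrow> f \<in> Mor C \<and> g \<in> Hom C (Cod C f) (Dom C f) \<and>
     g \<cdot>\<^bsub>C\<^esub> f = Id C (Dom C f) \<and> f \<cdot>\<^bsub>C\<^esub> g = Id C (Cod C f)"

definition iso_mor :: "('o, 'm, 'x) cat_data_scheme \<Rightarrow> 'm \<Rightarrow> bool" where
  "iso_mor C f \<longleftrightarrow> (\<exists>g. inverse_mor C f g)"

definition minv :: "('o, 'm, 'x) cat_data_scheme \<Rightarrow> 'm \<Rightarrow> 'm" where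
  "minv C f = (THE g. inverse_mor C f g)"

definition monic :: "('o, 'm, 'x) cat_data_scheme \<Rightarrow> 'm \<Rightarrow> bool" where
  "monic C f \<longleftrightarrow> f \<in> Mor C \<and>
     (\<forall>W. \<forall>g\<in>Hom C W (Dom C f). \<forall>h\<in>Hom C W (Dom C f). f \<cdot>\<^bsub>C\<^esub> g = f \<cdot>\<^bsub>C\<^esub> h \<longrightarrow> g = h)"

definition epic :: "('o, 'm, 'x) cat_data_scheme \<Rightarrow> 'm \<Rightarrow> bool" where
  "epic C f \<longleftrightarrow> f \<in> Mor C \<and>
     (\<forall>W. \<forall>g\<in>Hom C (Cod C f) W. \<forall>h\<in>Hom C (Cod C f) W. g \<cdot>\<^bsub>C\<^esub> f = h \<cdot>\<^bsub>C\<^esub> f \<longrightarrow> g = h)"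


section \<open>Abelian categories\<close>

definition zero_object :: "('o, 'm, 'x) cat_data_scheme \<Rightarrow> 'o \<Rightarrow> bool" where
  "zero_object C Z \<longleftrightarrow> Z \<in> Obj C \<and>
     (\<forall>X\<in>Obj C. (\<exists>!f. f \<in> Hom C Z X) \<and> (\<exists>!f. f \<in> Hom C X Z))"

definition zero_mor :: "('o, 'm, 'x) cat_data_scheme \<Rightarrow> 'm \<Rightarrow> bool" where
  "zero_mor C f \<longleftrightarrow> (\<exists>Z g h. zero_object C Z \<and>
     g \<in> Hom C (Dom C f) Z \<and> h \<in> Hom C Z (Cod C f) \<and> f \<in> Mor C \<and> f = h \<cdot>\<^bsub>C\<^esub> g)"

definition is_kernel :: "('o, 'm, 'x) cat_data_scheme \<Rightarrow> 'm \<Rightarrow> 'm \<Rightarrow> bool" where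
  "is_kernel C f k \<longleftrightarrow> f \<in> Mor C \<and> k \<in> Mor C \<and> Cod C k = Dom C f \<and> zero_mor C (f \<cdot>\<^bsub>C\<^esub> k) \<and>
     (\<forall>W. \<forall>g\<in>Hom C W (Dom C f). zero_mor C (f \<cdot>\<^bsub>C\<^esub> g) \<longrightarrow>
        (\<exists>!u. u \<in> Hom C W (Dom C k) \<and> k \<cdot>\<^bsub>C\<^esub> u = g))"

definition is_cokernel :: "('o, 'm, 'x) cat_data_scheme \<Rightarrow> 'm \<Rightarrow> 'm \<Rightarrow> bool" where
  "is_cokernel C f c \<longleftrightarrow> f \<in> Mor C \<and> c \<in> Mor C \<and> Dom C c = Cod C f \<and> zero_mor C (c \<cdot>\<^bsub>C\<^esub> f) \<and>
     (\<forall>W. \<forall>g\<in>Hom C (Cod C f) W. zero_mor C (g \<cdot>\<^bsub>C\<^esub> f) \<longrightarrow>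
        (\<exists>!u. u \<in> Hom C (Cod C c) W \<and> u \<cdot>\<^bsub>C\<^esub> c = g))"

text \<open>\<open>G X Y\<close> is the hom-set from \<open>X\<close> to \<open>Y\<close> as an abelian group; its multiplication is the
  addition of morphisms.\<close>

definition preadditive :: "('o, 'm, 'x) cat_data_scheme \<Rightarrow> ('o \<Rightarrow> 'o \<Rightarrow> 'm monoid) \<Rightarrow> bool" where
  "preadditive C G \<longleftrightarrow>
     (\<forall>X\<in>Obj C. \<forall>Y\<in>Obj C. comm_group (G X Y) \<and> carrier (G X Y) = Hom C X Y) \<and>
     (\<forall>X\<in>Obj C. \<forall>Y\<in>Obj C. \<forall>Z\<in>Obj C.
        (\<forall>g\<in>Hom C Y Z. (\<lambda>f. g \<cdot>\<^bsub>C\<^esub> f) \<in> hom (G X Y) (G X Z)) \<and>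
        (\<forall>f\<in>Hom C X Y. (\<lambda>g. g \<cdot>\<^bsub>C\<^esub> f) \<in> hom (G Y Z) (G X Z)))"

definition has_biproduct ::
  "('o, 'm, 'x) cat_data_scheme \<Rightarrow> ('o \<Rightarrow> 'o \<Rightarrow> 'm monoid) \<Rightarrow> 'o \<Rightarrow> 'o \<Rightarrow> bool" where
  "has_biproduct C G X Y \<longleftrightarrow> (\<exists>P\<in>Obj C. \<exists>i\<in>Hom C X P. \<exists>j\<in>Hom C Y P. \<exists>p\<in>Hom C P X. \<exists>q\<in>Hom C P Y.
     p \<cdot>\<^bsub>C\<^esub> i = Id C X \<and> q \<cdot>\<^bsub>C\<^esub> j = Id C Y \<and>
     (i \<cdot>\<^bsub>C\<^esub> p) \<otimes>\<^bsub>G P P\<^esub> (j \<cdot>\<^bsub>C\<^esub> q) = Id C P)"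

locale abelian_category = category C
  for C :: "('o, 'm, 'x) cat_data_scheme" (structure) +
  assumes additive: "\<exists>G. preadditive C G \<and> (\<forall>X\<in>Obj C. \<forall>Y\<in>Obj C. has_biproduct C G X Y)"
    and zero_object_exists: "\<exists>Z. zero_object C Z"
    and kernel_exists: "f \<in> Mor C \<Longrightarrow> \<exists>k. is_kernel C f k"
    and cokernel_exists: "f \<in> Mor C \<Longrightarrow> \<exists>c. is_cokernel C f c"
    and monic_is_kernel: "monic C k \<Longrightarrow> \<exists>f. is_kernel C f k"
    and epic_is_cokernel: "epic C c \<Longrightarrow> \<exists>f. is_cokernel C f c"


section \<open>Tensor categories\<close>

record ('o, 'm) tensor_data = "('o, 'm) cat_data" +
  TObj :: "'o \<Rightarrow> 'o \<Rightarrow> 'o"  (infixr \<open>\<otimes>\<^sub>o\<index>\<close> 70)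
  TMor :: "'m \<Rightarrow> 'm \<Rightarrow> 'm"  (infixr \<open>\<otimes>\<^sub>m\<index>\<close> 70)
  Unit :: "'o"  (\<open>\<I>\<index>\<close>)
  Assoc :: "'o \<Rightarrow> 'o \<Rightarrow> 'o \<Rightarrow> 'm"
  LUnit :: "'o \<Rightarrow> 'm"
  RUnit :: "'o \<Rightarrow> 'm"

locale tensor_category = category C
  for C :: "('o, 'm, 'x) tensor_data_scheme" (structure) +
  assumes TObj_Obj: "\<lbrakk>U \<in> Obj C; V \<in> Obj C\<rbrakk> \<Longrightarrow> U \<otimes>\<^sub>o V \<in> Obj C"
    and TMor_Hom: "\<lbrakk>f \<in> Hom C U U'; g \<in> Hom C V V'\<rbrakk>
          \<Longrightarrow> f \<otimes>\<^sub>m g \<in> Hom C (U \<otimes>\<^sub>o V) (U' \<otimes>\<^sub>o V')"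
    and TMor_Id: "\<lbrakk>U \<in> Obj C; V \<in> Obj C\<rbrakk> \<Longrightarrow> Id C U \<otimes>\<^sub>m Id C V = Id C (U \<otimes>\<^sub>o V)"
    and TMor_Comp: "\<lbrakk>f \<in> Hom C U U'; f' \<in> Hom C U' U''; g \<in> Hom C V V'; g' \<in> Hom C V' V''\<rbrakk>
          \<Longrightarrow> (f' \<cdot> f) \<otimes>\<^sub>m (g' \<cdot> g) = (f' \<otimes>\<^sub>m g') \<cdot> (f \<otimes>\<^sub>m g)"
    and Unit_Obj: "\<I> \<in> Obj C"
    and Assoc_Hom: "\<lbrakk>U \<in> Obj C; V \<in> Obj C; W \<in> Obj C\<rbrakk>
          \<Longrightarrow> Assoc C U V W \<in> Hom C (U \<otimes>\<^sub>o (V \<otimes>\<^sub>o W)) ((U \<otimes>\<^sub>o V) \<otimes>\<^sub>o W)"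
    and Assoc_iso: "\<lbrakk>U \<in> Obj C; V \<in> Obj C; W \<in> Obj C\<rbrakk> \<Longrightarrow> iso_mor C (Assoc C U V W)"
    and Assoc_natural: "\<lbrakk>f \<in> Hom C U U'; g \<in> Hom C V V'; h \<in> Hom C W W'\<rbrakk>
          \<Longrightarrow> Assoc C U' V' W' \<cdot> (f \<otimes>\<^sub>m (g \<otimes>\<^sub>m h)) = ((f \<otimes>\<^sub>m g) \<otimes>\<^sub>m h) \<cdot> Assoc C U V W"
    and LUnit_Hom: "U \<in> Obj C \<Longrightarrow> LUnit C U \<in> Hom C (\<I> \<otimes>\<^sub>o U) U"
    and LUnit_iso: "U \<in> Obj C \<Longrightarrow> iso_mor C (LUnit C U)"
    and LUnit_natural: "f \<in> Hom C U V \<Longrightarrow> LUnit C V \<cdot> (Id C \<I> \<otimes>\<^sub>m f) = f \<cdot> LUnit C U"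
    and RUnit_Hom: "U \<in> Obj C \<Longrightarrow> RUnit C U \<in> Hom C (U \<otimes>\<^sub>o \<I>) U"
    and RUnit_iso: "U \<in> Obj C \<Longrightarrow> iso_mor C (RUnit C U)"
    and RUnit_natural: "f \<in> Hom C U V \<Longrightarrow> RUnit C V \<cdot> (f \<otimes>\<^sub>m Id C \<I>) = f \<cdot> RUnit C U"
    and pentagon: "\<lbrakk>U \<in> Obj C; V \<in> Obj C; W \<in> Obj C; X \<in> Obj C\<rbrakk>
          \<Longrightarrow> Assoc C (U \<otimes>\<^sub>o V) W X \<cdot> Assoc C U V (W \<otimes>\<^sub>o X) =
              (Assoc C U V W \<otimes>\<^sub>m Id C X) \<cdot> Assoc C U (V \<otimes>\<^sub>o W) X \<cdot> (Id C U \<otimes>\<^sub>m Assoc C V W X)"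
    and triangle: "\<lbrakk>U \<in> Obj C; V \<in> Obj C\<rbrakk>
          \<Longrightarrow> (RUnit C U \<otimes>\<^sub>m Id C V) \<cdot> Assoc C U \<I> V = Id C U \<otimes>\<^sub>m LUnit C V"

locale abelian_tensor_category = tensor_category C + abelian_category C
  for C :: "('o, 'm, 'x) tensor_data_scheme" (structure)


section \<open>Condition C\<close>

text \<open>\<open>SPair C U V\<close> is \<open>\<pi>\<^bsub>U,V\<^esub>\<close> and \<open>SBidual C U\<close> is \<open>\<delta>\<^sub>U\<close>.\<close>

record ('o, 'm) star_data = "('o, 'm) tensor_data" +
  SObj :: "'o \<Rightarrow> 'o"  (\<open>(_\<^sup>\<star>\<index>)\<close> [1000] 999)
  SMor :: "'m \<Rightarrow> 'm"
  SBidual :: "'o \<Rightarrow> 'm"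
  SPair :: "'o \<Rightarrow> 'o \<Rightarrow> 'm \<Rightarrow> 'm"

locale condition_C = tensor_category C
  for C :: "('o, 'm, 'x) star_data_scheme" (structure) +
  assumes SObj_Obj: "U \<in> Obj C \<Longrightarrow> U\<^sup>\<star> \<in> Obj C"
    and SMor_Hom: "f \<in> Hom C U V \<Longrightarrow> SMor C f \<in> Hom C (V\<^sup>\<star>) (U\<^sup>\<star>)"
    and SMor_Id: "U \<in> Obj C \<Longrightarrow> SMor C (Id C U) = Id C (U\<^sup>\<star>)"
    and SMor_Comp: "\<lbrakk>f \<in> Hom C U V; g \<in> Hom C V W\<rbrakk> \<Longrightarrow> SMor C (g \<cdot> f) = SMor C f \<cdot> SMor C g"
    and SBidual_Hom: "U \<in> Obj C \<Longrightarrow> SBidual C U \<in> Hom C U ((U\<^sup>\<star>)\<^sup>\<star>)"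
    and SBidual_iso: "U \<in> Obj C \<Longrightarrow> iso_mor C (SBidual C U)"
    and SBidual_natural: "f \<in> Hom C U V
          \<Longrightarrow> SBidual C V \<cdot> f = SMor C (SMor C f) \<cdot> SBidual C U"
    and SPair_bij: "\<lbrakk>U \<in> Obj C; V \<in> Obj C\<rbrakk>
          \<Longrightarrow> bij_betw (SPair C U V) (Hom C U (V\<^sup>\<star>)) (Hom C (U \<otimes>\<^sub>o V) (\<I>\<^sup>\<star>))"
    and SPair_natural: "\<lbrakk>f \<in> Hom C U' U; g \<in> Hom C V' V; p \<in> Hom C U (V\<^sup>\<star>)\<rbrakk>
          \<Longrightarrow> SPair C U' V' (SMor C g \<cdot> p \<cdot> f) = SPair C U V p \<cdot> (f \<otimes>\<^sub>m g)"

definition nondegenerate ::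
  "('o, 'm, 'x) star_data_scheme \<Rightarrow> 'o \<Rightarrow> 'o \<Rightarrow> 'm \<Rightarrow> bool" where
  "nondegenerate C U V p \<longleftrightarrow> p \<in> Hom C (U \<otimes>\<^sub>o\<^bsub>C\<^esub> V) (\<I>\<^bsub>C\<^esub>\<^sup>\<star>\<^bsub>C\<^esub>) \<and>
     iso_mor C (inv_into (Hom C U (V\<^sup>\<star>\<^bsub>C\<^esub>)) (SPair C U V) p)"


section \<open>Duals and the subcategory of dualisable objects\<close>

definition right_dual ::
  "('o, 'm, 'x) tensor_data_scheme \<Rightarrow> 'o \<Rightarrow> 'o \<Rightarrow> 'm \<Rightarrow> 'm \<Rightarrow> bool" where
  "right_dual C U V b d \<longleftrightarrow> U \<in> Obj C \<and> V \<in> Obj C \<and>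
     b \<in> Hom C \<I>\<^bsub>C\<^esub> (U \<otimes>\<^sub>o\<^bsub>C\<^esub> V) \<and> d \<in> Hom C (V \<otimes>\<^sub>o\<^bsub>C\<^esub> U) \<I>\<^bsub>C\<^esub> \<and>
     RUnit C U \<cdot>\<^bsub>C\<^esub> (Id C U \<otimes>\<^sub>m\<^bsub>C\<^esub> d) \<cdot>\<^bsub>C\<^esub> minv C (Assoc C U V U) \<cdot>\<^bsub>C\<^esub>
       (b \<otimes>\<^sub>m\<^bsub>C\<^esub> Id C U) \<cdot>\<^bsub>C\<^esub> minv C (LUnit C U) = Id C U \<and>
     LUnit C V \<cdot>\<^bsub>C\<^esub> (d \<otimes>\<^sub>m\<^bsub>C\<^esub> Id C V) \<cdot>\<^bsub>C\<^esub> Assoc C V U V \<cdot>\<^bsub>C\<^esub>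
       (Id C V \<otimes>\<^sub>m\<^bsub>C\<^esub> b) \<cdot>\<^bsub>C\<^esub> minv C (RUnit C V) = Id C V"

definition left_dual ::
  "('o, 'm, 'x) tensor_data_scheme \<Rightarrow> 'o \<Rightarrow> 'o \<Rightarrow> 'm \<Rightarrow> 'm \<Rightarrow> bool" where
  "left_dual C U V b d \<longleftrightarrow> U \<in> Obj C \<and> V \<in> Obj C \<and>
     b \<in> Hom C \<I>\<^bsub>C\<^esub> (V \<otimes>\<^sub>o\<^bsub>C\<^esub> U) \<and> d \<in> Hom C (U \<otimes>\<^sub>o\<^bsub>C\<^esub> V) \<I>\<^bsub>C\<^esub> \<and>
     LUnit C U \<cdot>\<^bsub>C\<^esub> (d \<otimes>\<^sub>m\<^bsub>C\<^esub> Id C U) \<cdot>\<^bsub>C\<^esub> Assoc C U V U \<cdot>\<^bsub>C\<^esub>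
       (Id C U \<otimes>\<^sub>m\<^bsub>C\<^esub> b) \<cdot>\<^bsub>C\<^esub> minv C (RUnit C U) = Id C U \<and>
     RUnit C V \<cdot>\<^bsub>C\<^esub> (Id C V \<otimes>\<^sub>m\<^bsub>C\<^esub> d) \<cdot>\<^bsub>C\<^esub> minv C (Assoc C V U V) \<cdot>\<^bsub>C\<^esub>
       (b \<otimes>\<^sub>m\<^bsub>C\<^esub> Id C V) \<cdot>\<^bsub>C\<^esub> minv C (LUnit C V) = Id C V"

definition b_duality ::
  "('o, 'm, 'x) star_data_scheme \<Rightarrow> 'o \<Rightarrow> 'm \<Rightarrow> 'm \<Rightarrow> 'm \<Rightarrow> 'm \<Rightarrow> bool" where
  "b_duality C U b d b' d' \<longleftrightarrow>
     right_dual C U (U\<^sup>\<star>\<^bsub>C\<^esub>) b d \<and> left_dual C U (U\<^sup>\<star>\<^bsub>C\<^esub>) b' d' \<and> monic C b \<and> monic C b'"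

definition Cb :: "('o, 'm, 'x) star_data_scheme \<Rightarrow> 'o set" where
  "Cb C = {U \<in> Obj C. \<exists>b d b' d'. b_duality C U b d b' d'}"

definition chosen_dualities ::
  "('o, 'm, 'x) star_data_scheme \<Rightarrow> ('o \<Rightarrow> 'm) \<Rightarrow> ('o \<Rightarrow> 'm) \<Rightarrow> ('o \<Rightarrow> 'm) \<Rightarrow> ('o \<Rightarrow> 'm) \<Rightarrow> bool"
  where "chosen_dualities C b d b' d' \<longleftrightarrow> (\<forall>U\<in>Cb C. b_duality C U (b U) (d U) (b' U) (d' U))"


section \<open>Internal Homs\<close>

definition internal_hom ::
  "('o, 'm, 'x) tensor_data_scheme \<Rightarrow> 'o \<Rightarrow> 'o \<Rightarrow> 'o \<Rightarrow> ('o \<Rightarrow> 'm \<Rightarrow> 'm) \<Rightarrow> bool" where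
  "internal_hom C A B H \<phi> \<longleftrightarrow> A \<in> Obj C \<and> B \<in> Obj C \<and> H \<in> Obj C \<and>
     (\<forall>X\<in>Obj C. bij_betw (\<phi> X) (Hom C (X \<otimes>\<^sub>o\<^bsub>C\<^esub> A) B) (Hom C X H)) \<and>
     (\<forall>X\<in>Obj C. \<forall>X'\<in>Obj C. \<forall>f\<in>Hom C X' X. \<forall>p\<in>Hom C (X \<otimes>\<^sub>o\<^bsub>C\<^esub> A) B.
        \<phi> X' (p \<cdot>\<^bsub>C\<^esub> (f \<otimes>\<^sub>m\<^bsub>C\<^esub> Id C A)) = \<phi> X p \<cdot>\<^bsub>C\<^esub> f)"

definition ihom :: "('o, 'm, 'x) star_data_scheme \<Rightarrow> 'o \<Rightarrow> 'o \<Rightarrow> 'o" where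
  "ihom C A B = B \<otimes>\<^sub>o\<^bsub>C\<^esub> A\<^sup>\<star>\<^bsub>C\<^esub>"

definition ihom_iso ::
  "('o, 'm, 'x) star_data_scheme \<Rightarrow> ('o \<Rightarrow> 'm) \<Rightarrow> 'o \<Rightarrow> 'o \<Rightarrow> 'm \<Rightarrow> 'm" where
  "ihom_iso C b A X f = (f \<otimes>\<^sub>m\<^bsub>C\<^esub> Id C (A\<^sup>\<star>\<^bsub>C\<^esub>)) \<cdot>\<^bsub>C\<^esub> Assoc C X A (A\<^sup>\<star>\<^bsub>C\<^esub>) \<cdot>\<^bsub>C\<^esub>
     (Id C X \<otimes>\<^sub>m\<^bsub>C\<^esub> b A) \<cdot>\<^bsub>C\<^esub> minv C (RUnit C X)"

text \<open>The multiplication \<open>m\<^bsub>Z,Y,X\<^esub> = id\<^sub>Z \<otimes> d\<^sub>Y \<otimes> id\<^bsub>X\<^sup>*\<^esub>\<close> with the coherence isomorphisms made explicit, along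
  \<open>(Z \<otimes> Y\<^sup>*) \<otimes> (Y \<otimes> X\<^sup>*) \<rightarrow> Z \<otimes> (Y\<^sup>* \<otimes> (Y \<otimes> X\<^sup>*)) \<rightarrow> Z \<otimes> ((Y\<^sup>* \<otimes> Y) \<otimes> X\<^sup>*) \<rightarrow> Z \<otimes> (1 \<otimes> X\<^sup>*) \<rightarrow> Z \<otimes> X\<^sup>*\<close>.
  By coherence every other bracketing gives the same morphism.\<close>

definition ihom_mult ::
  "('o, 'm, 'x) star_data_scheme \<Rightarrow> ('o \<Rightarrow> 'm) \<Rightarrow> 'o \<Rightarrow> 'o \<Rightarrow> 'o \<Rightarrow> 'm" where
  "ihom_mult C d Z Y X =
     (Id C Z \<otimes>\<^sub>m\<^bsub>C\<^esub> LUnit C (X\<^sup>\<star>\<^bsub>C\<^esub>)) \<cdot>\<^bsub>C\<^esub>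
     (Id C Z \<otimes>\<^sub>m\<^bsub>C\<^esub> (d Y \<otimes>\<^sub>m\<^bsub>C\<^esub> Id C (X\<^sup>\<star>\<^bsub>C\<^esub>))) \<cdot>\<^bsub>C\<^esub>
     (Id C Z \<otimes>\<^sub>m\<^bsub>C\<^esub> Assoc C (Y\<^sup>\<star>\<^bsub>C\<^esub>) Y (X\<^sup>\<star>\<^bsub>C\<^esub>)) \<cdot>\<^bsub>C\<^esub>
     minv C (Assoc C Z (Y\<^sup>\<star>\<^bsub>C\<^esub>) (Y \<otimes>\<^sub>o\<^bsub>C\<^esub> X\<^sup>\<star>\<^bsub>C\<^esub>))"

definition ihom_unit :: "('o \<Rightarrow> 'm) \<Rightarrow> 'o \<Rightarrow> 'm" where
  "ihom_unit b A = b A"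

definition ihom_eps :: "('o, 'm, 'x) star_data_scheme \<Rightarrow> 'o \<Rightarrow> 'm" where
  "ihom_eps C A = SPair C A (A\<^sup>\<star>\<^bsub>C\<^esub>) (SBidual C A)"

end

theory Submission
  imports Defs
begin

text \<open>A right dual \<open>V\<close> of \<open>U\<close> makes \<open>- \<otimes> V\<close> right adjoint to \<open>- \<otimes> U\<close>, by the zigzag identities and
  Kelly's identity \<open>\<rho>\<^bsub>X\<otimes>U\<^esub> \<circ> \<alpha>\<^bsub>X,U,1\<^esub> = id\<^sub>X \<otimes> \<rho>\<^sub>U\<close>; for \<open>V = A\<^sup>*\<close> this is the internal Hom. The pairing is
  non-degenerate by Yoneda: composition with \<open>\<pi>\<^sup>-\<^sup>1\<close> of it is the chain of bijections
  \<open>Hom(X, A \<otimes> B\<^sup>*) \<cong> Hom(X \<otimes> B, A) \<cong> Hom(X \<otimes> B, A\<^sup>*\<^sup>*) \<cong> Hom((X \<otimes> B) \<otimes> A\<^sup>*, 1\<^sup>*) \<cong> Hom(X, (B \<otimes> A\<^sup>*)\<^sup>*)\<close>.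
  If \<open>B \<otimes> A\<^sup>*\<close> is zero, so is \<open>(B \<otimes> A\<^sup>*) \<otimes> A\<close>; injectivity of the left coevaluations of \<open>A\<close> and \<open>B\<close> then
  forces every two morphisms into the unit object to agree, and with Condition C the same holds for
  every two parallel morphisms.\<close>

section \<open>Calculating with morphisms\<close>

context category
begin

lemma Hom_iff: "f \<in> Hom C X Y \<longleftrightarrow> f \<in> Mor C \<and> Dom C f = X \<and> Cod C f = Y"
  by (auto simp: Hom_def)

lemma Id_typing:
  assumes "X \<in> Obj C"
  shows "Id C X \<in> Mor C" "Dom C (Id C X) = X" "Cod C (Id C X) = X"
  using Id_Hom[OF assms] by (auto simp: Hom_iff)

lemma Comp_typing:
  assumes "f \<in> Mor C" "g \<in> Mor C" "Cod C f = Dom C g"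
  shows "g \<cdot> f \<in> Mor C" "Dom C (g \<cdot> f) = Dom C f" "Cod C (g \<cdot> f) = Cod C g"
  using Comp_Hom[of f "Dom C f" "Dom C g" g "Cod C g"] assms by (auto simp: Hom_iff)

lemma Id_neutral:
  "f \<in> Mor C \<Longrightarrow> Cod C f = X \<Longrightarrow> Id C X \<cdot> f = f"
  "f \<in> Mor C \<Longrightarrow> Dom C f = X \<Longrightarrow> f \<cdot> Id C X = f"
  using Id_left Id_right by (auto simp: Hom_iff)

lemma Comp_assoc':
  assumes "f \<in> Mor C" "g \<in> Mor C" "h \<in> Mor C" "Cod C f = Dom C g" "Cod C g = Dom C h"
  shows "(h \<cdot> g) \<cdot> f = h \<cdot> (g \<cdot> f)"
  by (rule Comp_assoc) (use assms in \<open>auto simp: Hom_iff\<close>)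

lemmas cat_simps = Dom_Obj Cod_Obj Id_typing Comp_typing Id_neutral Comp_assoc'

text \<open>Composites are normalised to nest to the right, so a two-factor equation does not match
  in front of a further factor \<open>x\<close>; this form supplies that tail.\<close>

lemma Comp_rewrite:
  assumes "g \<cdot> f = k" "f \<in> Mor C" "g \<in> Mor C" "x \<in> Mor C" "Cod C f = Dom C g" "Cod C x = Dom C f"
  shows "g \<cdot> (f \<cdot> x) = k \<cdot> x"
  using assms Comp_assoc' by metis

lemma minv_typing:
  assumes "iso_mor C f"
  shows "f \<in> Mor C" "minv C f \<in> Mor C" "Dom C (minv C f) = Cod C f" "Cod C (minv C f) = Dom C f"
    and minv_Comp: "minv C f \<cdot> f = Id C (Dom C f)"
    and Comp_minv: "f \<cdot> minv C f = Id C (Cod C f)"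
proof -
  obtain g where g: "inverse_mor C f g"
    using assms by (auto simp: iso_mor_def)
  \<comment> \<open>Inverses are unique, so the description operator in \<open>minv\<close> denotes
    \<open>g\<close>.\<close>
  have "h = g" if h: "inverse_mor C f h" for h
  proof -
    have "h = h \<cdot> (f \<cdot> g)"
      using g h by (simp add: inverse_mor_def Hom_iff cat_simps)
    also have "\<dots> = (h \<cdot> f) \<cdot> g"
      by (rule Comp_assoc'[symmetric]) (use g h in \<open>simp_all add: inverse_mor_def Hom_iff\<close>)
    also have "\<dots> = g"
      using g h by (simp add: inverse_mor_def Hom_iff cat_simps)
    finally show ?thesis .
  qed
  with g have "minv C f = g"
    unfolding minv_def by blast
  with g show "f \<in> Mor C" "minv C f \<in> Mor C" "Dom C (minv C f) = Cod C f"
    "Cod C (minv C f) = Dom C f" "minv C f \<cdot> f = Id C (Dom C f)" "f \<cdot> minv C f = Id C (Cod C f)"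
    by (auto simp: inverse_mor_def Hom_iff)
qed

lemma iso_cancel_right:
  assumes "iso_mor C a" "f \<in> Mor C" "g \<in> Mor C" "Dom C f = Cod C a" "Dom C g = Cod C a"
    and "f \<cdot> a = g \<cdot> a"
  shows "f = g"
proof -
  have "(f \<cdot> a) \<cdot> minv C a = (g \<cdot> a) \<cdot> minv C a"
    using assms by simp
  then show ?thesis
    using assms(1-5) by (simp add: cat_simps minv_typing Comp_minv)
qed

lemma iso_cancel_left:
  assumes "iso_mor C a" "f \<in> Mor C" "g \<in> Mor C" "Cod C f = Dom C a" "Cod C g = Dom C a"
    and "a \<cdot> f = a \<cdot> g"
  shows "f = g"
proof -
  have "minv C a \<cdot> (a \<cdot> f) = minv C a \<cdot> (a \<cdot> g)"
    using assms by simp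
  then show ?thesis
    using assms(1-5)
    by (simp add: Comp_assoc'[symmetric] minv_typing minv_Comp Id_neutral del: Comp_assoc')
qed

lemma bij_betw_Comp_iso:
  assumes a: "iso_mor C a"
  shows "bij_betw (\<lambda>f. a \<cdot> f) (Hom C X (Dom C a)) (Hom C X (Cod C a))"
    and "bij_betw (\<lambda>f. f \<cdot> a) (Hom C (Cod C a) X) (Hom C (Dom C a) X)"
  by (rule bij_betwI[where g = "\<lambda>f. minv C a \<cdot> f"];
      use a in \<open>auto simp: Hom_iff cat_simps minv_typing Comp_assoc'[symmetric] minv_Comp Comp_minv
        simp del: Comp_assoc'\<close>)
    (rule bij_betwI[where g = "\<lambda>f. f \<cdot> minv C a"];
      use a in \<open>auto simp: Hom_iff cat_simps minv_typing minv_Comp Comp_minv\<close>)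

text \<open>Yoneda: surjectivity at \<open>Q\<close> yields \<open>s\<close> with
  \<open>t \<cdot> s\<close> the identity. Then \<open>t \<cdot> (s \<cdot> t)\<close> and
  \<open>t \<cdot> Id C P\<close> agree, and injectivity at \<open>P\<close> makes \<open>s\<close>
  a two-sided inverse.\<close>

lemma iso_mor_if_bij_betw_Comp:
  assumes t: "t \<in> Hom C P Q"
    and bij: "\<And>X. X \<in> Obj C \<Longrightarrow> bij_betw (\<lambda>f. t \<cdot> f) (Hom C X P) (Hom C X Q)"
  shows "iso_mor C t"
proof -
  have PQ: "P \<in> Obj C" "Q \<in> Obj C"
    using t by (auto simp: Hom_iff cat_simps)
  have "Id C Q \<in> (\<lambda>f. t \<cdot> f) ` Hom C Q P"
    using bij[OF PQ(2)] Id_Hom[OF PQ(2)] by (simp add: bij_betw_def)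
  then obtain s where s: "s \<in> Hom C Q P" "t \<cdot> s = Id C Q"
    by auto
  have "t \<cdot> (s \<cdot> t) = (t \<cdot> s) \<cdot> t"
    using s(1) t by (simp add: Comp_assoc' Hom_iff)
  also have "\<dots> = t \<cdot> Id C P"
    using s(2) t PQ by (simp add: cat_simps Hom_iff)
  finally have "t \<cdot> (s \<cdot> t) = t \<cdot> Id C P" .
  moreover have "s \<cdot> t \<in> Hom C P P" "Id C P \<in> Hom C P P"
    using s(1) t PQ by (auto simp: cat_simps Hom_iff)
  ultimately have "s \<cdot> t = Id C P"
    using bij[OF PQ(1)] by (auto simp: bij_betw_def dest: inj_onD)
  with s t show ?thesis
    by (auto simp: iso_mor_def inverse_mor_def Hom_iff)
qed

end


section \<open>Right duals and adjunctions\<close>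

context tensor_category
begin

lemma TMor_typing:
  assumes "f \<in> Mor C" "g \<in> Mor C"
  shows "f \<otimes>\<^sub>m g \<in> Mor C" "Dom C (f \<otimes>\<^sub>m g) = Dom C f \<otimes>\<^sub>o Dom C g"
    "Cod C (f \<otimes>\<^sub>m g) = Cod C f \<otimes>\<^sub>o Cod C g"
  using TMor_Hom[of f "Dom C f" "Cod C f" g "Dom C g" "Cod C g"] assms by (auto simp: Hom_iff)

lemma Assoc_typing:
  assumes "U \<in> Obj C" "V \<in> Obj C" "W \<in> Obj C"
  shows "Assoc C U V W \<in> Mor C" "Dom C (Assoc C U V W) = U \<otimes>\<^sub>o V \<otimes>\<^sub>o W"
    "Cod C (Assoc C U V W) = (U \<otimes>\<^sub>o V) \<otimes>\<^sub>o W"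
  using Assoc_Hom[OF assms] by (auto simp: Hom_iff)

lemma LUnit_typing:
  assumes "U \<in> Obj C"
  shows "LUnit C U \<in> Mor C" "Dom C (LUnit C U) = \<I> \<otimes>\<^sub>o U" "Cod C (LUnit C U) = U"
  using LUnit_Hom[OF assms] by (auto simp: Hom_iff)

lemma RUnit_typing:
  assumes "U \<in> Obj C"
  shows "RUnit C U \<in> Mor C" "Dom C (RUnit C U) = U \<otimes>\<^sub>o \<I>" "Cod C (RUnit C U) = U"
  using RUnit_Hom[OF assms] by (auto simp: Hom_iff)

lemmas tensor_simps = cat_simps TMor_typing TObj_Obj TMor_Id Unit_Obj Assoc_typing LUnit_typing
  RUnit_typing Assoc_iso LUnit_iso RUnit_iso minv_typing(2-) minv_Comp Comp_minv

lemma interchange: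
  assumes "f \<in> Mor C" "f' \<in> Mor C" "g \<in> Mor C" "g' \<in> Mor C"
    and "Cod C f = Dom C f'" "Cod C g = Dom C g'"
  shows "(f' \<otimes>\<^sub>m g') \<cdot> (f \<otimes>\<^sub>m g) = (f' \<cdot> f) \<otimes>\<^sub>m (g' \<cdot> g)"
  by (rule TMor_Comp[symmetric]) (use assms in \<open>auto simp: Hom_iff\<close>)

lemma iso_mor_TMor:
  assumes "iso_mor C f" "iso_mor C g"
  shows "iso_mor C (f \<otimes>\<^sub>m g)"
  unfolding iso_mor_def inverse_mor_def
  by (rule exI[of _ "minv C f \<otimes>\<^sub>m minv C g"])
    (use assms in \<open>simp add: Hom_iff tensor_simps minv_typing(1) interchange\<close>)

lemma iso_mor_Id: "X \<in> Obj C \<Longrightarrow> iso_mor C (Id C X)"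
  unfolding iso_mor_def inverse_mor_def
  by (rule exI[of _ "Id C X"]) (simp add: Hom_iff cat_simps)

lemma iso_mor_Comp:
  assumes "iso_mor C f" "iso_mor C g" "Cod C f = Dom C g"
  shows "iso_mor C (g \<cdot> f)"
proof -
  have "g \<cdot> f \<cdot> minv C f \<cdot> minv C g = Id C (Cod C g)"
    using assms Comp_rewrite[OF Comp_minv[OF assms(1)], of "minv C g"]
    by (simp add: tensor_simps minv_typing(1))
  moreover have "minv C f \<cdot> minv C g \<cdot> g \<cdot> f = Id C (Dom C f)"
    using assms Comp_rewrite[OF minv_Comp[OF assms(2)], of f]
    by (simp add: tensor_simps minv_typing(1))
  ultimately show ?thesis
    unfolding iso_mor_def inverse_mor_def
    by (intro exI[of _ "minv C f \<cdot> minv C g"])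
      (use assms in \<open>simp add: Hom_iff tensor_simps minv_typing(1)\<close>)
qed

lemma Assoc_natural':
  assumes "f \<in> Mor C" "g \<in> Mor C" "h \<in> Mor C"
  shows "Assoc C (Cod C f) (Cod C g) (Cod C h) \<cdot> (f \<otimes>\<^sub>m g \<otimes>\<^sub>m h) =
    ((f \<otimes>\<^sub>m g) \<otimes>\<^sub>m h) \<cdot> Assoc C (Dom C f) (Dom C g) (Dom C h)"
  by (rule Assoc_natural) (use assms in \<open>auto simp: Hom_iff\<close>)

lemma minv_Assoc_natural:
  assumes "f \<in> Mor C" "g \<in> Mor C" "h \<in> Mor C"
  shows "minv C (Assoc C (Cod C f) (Cod C g) (Cod C h)) \<cdot> ((f \<otimes>\<^sub>m g) \<otimes>\<^sub>m h) =
    (f \<otimes>\<^sub>m g \<otimes>\<^sub>m h) \<cdot> minv C (Assoc C (Dom C f) (Dom C g) (Dom C h))"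
  (is "minv C ?a' \<cdot> ?l = ?r \<cdot> minv C ?a")
proof (rule iso_cancel_left[of ?a'])
  have "?a' \<cdot> (?r \<cdot> minv C ?a) = (?l \<cdot> ?a) \<cdot> minv C ?a"
    using assms by (simp add: Assoc_natural'[symmetric] tensor_simps)
  also have "\<dots> = ?a' \<cdot> (minv C ?a' \<cdot> ?l)"
    using assms Comp_rewrite[OF Comp_minv[of ?a'], of ?l] by (simp add: tensor_simps)
  finally show "?a' \<cdot> minv C ?a' \<cdot> ?l = ?a' \<cdot> ?r \<cdot> minv C ?a" by simp
qed (use assms in \<open>simp_all add: tensor_simps\<close>)

text \<open>Tensoring with the unit object is faithful, because \<rho> is a natural isomorphism from
  it to the identity functor.\<close>

lemma TMor_Id_Unit_cancel:
  assumes "f \<in> Hom C X Y" "g \<in> Hom C X Y" "f \<otimes>\<^sub>m Id C \<I> = g \<otimes>\<^sub>m Id C \<I>"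
  shows "f = g"
proof (rule iso_cancel_right[of "RUnit C X"])
  show "f \<cdot> RUnit C X = g \<cdot> RUnit C X"
    using RUnit_natural[OF assms(1)] RUnit_natural[OF assms(2)] assms(3) by simp
qed (use assms in \<open>auto simp: Hom_iff tensor_simps\<close>)

text \<open>Kelly's argument: by faithfulness it suffices to compare both sides after tensoring with
  \<open>\<I>\<close>. There the pentagon for \<open>U, V, \<I>, \<I>\<close>, the triangle used
  twice and naturality of \<alpha> identify them.\<close>

lemma RUnit_TObj:
  assumes [simp]: "U \<in> Obj C" "V \<in> Obj C"
  shows "RUnit C (U \<otimes>\<^sub>o V) \<cdot> Assoc C U V \<I> = Id C U \<otimes>\<^sub>m RUnit C V"
proof (rule TMor_Id_Unit_cancel)
  note [simp] = tensor_simps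
  let ?I = "Id C \<I>"
  \<comment> \<open>These are the last two factors of the pentagon; being invertible, they are
    cancelled at the end.\<close>
  let ?a = "Assoc C U (V \<otimes>\<^sub>o \<I>) \<I> \<cdot> (Id C U \<otimes>\<^sub>m Assoc C V \<I> \<I>)"
  have "((RUnit C (U \<otimes>\<^sub>o V) \<cdot> Assoc C U V \<I>) \<otimes>\<^sub>m ?I) \<cdot> ?a
      = ((RUnit C (U \<otimes>\<^sub>o V) \<otimes>\<^sub>m ?I) \<cdot> (Assoc C U V \<I> \<otimes>\<^sub>m ?I)) \<cdot> ?a"
    by (simp add: interchange del: Comp_assoc')
  also have "\<dots> = (RUnit C (U \<otimes>\<^sub>o V) \<otimes>\<^sub>m ?I) \<cdot> Assoc C (U \<otimes>\<^sub>o V) \<I> \<I> \<cdot> Assoc C U V (\<I> \<otimes>\<^sub>o \<I>)"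
    by (simp add: pentagon)
  also have "\<dots> = (Id C (U \<otimes>\<^sub>o V) \<otimes>\<^sub>m LUnit C \<I>) \<cdot> Assoc C U V (\<I> \<otimes>\<^sub>o \<I>)"
    by (rule Comp_rewrite[OF triangle]) simp_all
  also have "\<dots> = Assoc C U V \<I> \<cdot> (Id C U \<otimes>\<^sub>m Id C V \<otimes>\<^sub>m LUnit C \<I>)"
    using Assoc_natural'[of "Id C U" "Id C V" "LUnit C \<I>"] by (simp del: TMor_Id add: TMor_Id[symmetric])
  also have "\<dots> = Assoc C U V \<I> \<cdot> (Id C U \<otimes>\<^sub>m (RUnit C V \<otimes>\<^sub>m ?I)) \<cdot> (Id C U \<otimes>\<^sub>m Assoc C V \<I> \<I>)"
    by (simp add: interchange triangle)
  also have "\<dots> = ((Id C U \<otimes>\<^sub>m RUnit C V) \<otimes>\<^sub>m ?I) \<cdot> ?a"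
    using Comp_rewrite[OF Assoc_natural'[of "Id C U" "RUnit C V" ?I], of "Id C U \<otimes>\<^sub>m Assoc C V \<I> \<I>"]
    by simp
  finally show "(RUnit C (U \<otimes>\<^sub>o V) \<cdot> Assoc C U V \<I>) \<otimes>\<^sub>m ?I = (Id C U \<otimes>\<^sub>m RUnit C V) \<otimes>\<^sub>m ?I"
    by (rule iso_cancel_right[rotated -1]) (simp_all add: iso_mor_Comp iso_mor_TMor iso_mor_Id)
qed (simp_all add: Hom_iff tensor_simps)

end


text \<open>A locale, so that the adjunction can be instantiated for several pairs: \<open>A\<close>
  with its star, and the stars of \<open>A\<close> and \<open>B\<close> with \<open>A\<close> and
  \<open>B\<close> as their right duals.\<close>

locale right_dual_pair = tensor_category C
  for C :: "('o, 'm, 'x) tensor_data_scheme" (structure) +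
  fixes U V :: 'o and b d :: 'm
  assumes dual: "right_dual C U V b d"
begin

lemma dual_typing:
  "U \<in> Obj C" "V \<in> Obj C"
  "b \<in> Mor C" "Dom C b = \<I>" "Cod C b = U \<otimes>\<^sub>o V"
  "d \<in> Mor C" "Dom C d = V \<otimes>\<^sub>o U" "Cod C d = \<I>"
  using dual by (auto simp: right_dual_def Hom_iff)

lemmas dual_simps = tensor_simps dual_typing

text \<open>The unit of the adjunction between \<open>- \<otimes> U\<close> and
  \<open>- \<otimes> V\<close>.\<close>

definition coev :: "'o \<Rightarrow> 'm" where
  "coev X = Assoc C X U V \<cdot> (Id C X \<otimes>\<^sub>m b) \<cdot> minv C (RUnit C X)"

text \<open>The counit of the same adjunction.\<close>

definition ev :: "'o \<Rightarrow> 'm" where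
  "ev Y = RUnit C Y \<cdot> (Id C Y \<otimes>\<^sub>m d) \<cdot> minv C (Assoc C Y V U)"

text \<open>Transposition; for the chosen duality of \<open>A\<close> it is
  \<open>ihom_iso\<close>.\<close>

definition curry_mor :: "'o \<Rightarrow> 'm \<Rightarrow> 'm" where
  "curry_mor X f = (f \<otimes>\<^sub>m Id C V) \<cdot> coev X"

definition uncurry_mor :: "'o \<Rightarrow> 'm \<Rightarrow> 'm" where
  "uncurry_mor Y g = ev Y \<cdot> (g \<otimes>\<^sub>m Id C U)"

lemma coev_typing:
  assumes "X \<in> Obj C"
  shows "coev X \<in> Mor C" "Dom C (coev X) = X" "Cod C (coev X) = (X \<otimes>\<^sub>o U) \<otimes>\<^sub>o V"
  using assms by (simp_all add: coev_def dual_simps)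

lemma ev_typing:
  assumes "Y \<in> Obj C"
  shows "ev Y \<in> Mor C" "Dom C (ev Y) = (Y \<otimes>\<^sub>o V) \<otimes>\<^sub>o U" "Cod C (ev Y) = Y"
  using assms by (simp_all add: ev_def dual_simps)

lemma coev_natural:
  assumes f: "f \<in> Hom C X Y"
  shows "coev Y \<cdot> f = ((f \<otimes>\<^sub>m Id C U) \<otimes>\<^sub>m Id C V) \<cdot> coev X"
proof (rule iso_cancel_right[of "RUnit C X"])
  have [simp]: "f \<in> Mor C" "Dom C f = X" "Cod C f = Y" "X \<in> Obj C" "Y \<in> Obj C"
    using f by (auto simp: Hom_iff cat_simps)
  note [simp] = dual_simps
  \<comment> \<open>Composing with \<rho> on the right removes the inverse of \<rho> inside
    \<open>coev\<close>, so naturality of \<rho> itself applies.\<close>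
  have "(coev Y \<cdot> f) \<cdot> RUnit C X
      = Assoc C Y U V \<cdot> (Id C Y \<otimes>\<^sub>m b) \<cdot> minv C (RUnit C Y) \<cdot> RUnit C Y \<cdot> (f \<otimes>\<^sub>m Id C \<I>)"
    by (simp add: coev_def RUnit_natural[OF f])
  also have "\<dots> = Assoc C Y U V \<cdot> (Id C Y \<otimes>\<^sub>m b) \<cdot> (f \<otimes>\<^sub>m Id C \<I>)"
    by (subst Comp_rewrite[OF minv_Comp]) simp_all
  also have "\<dots> = Assoc C Y U V \<cdot> (f \<otimes>\<^sub>m Id C (U \<otimes>\<^sub>o V)) \<cdot> (Id C X \<otimes>\<^sub>m b)"
    by (simp add: interchange)
  also have "\<dots> = ((f \<otimes>\<^sub>m Id C U) \<otimes>\<^sub>m Id C V) \<cdot> Assoc C X U V \<cdot> (Id C X \<otimes>\<^sub>m b)"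
    using Comp_rewrite[OF Assoc_natural'[of f "Id C U" "Id C V"], of "Id C X \<otimes>\<^sub>m b"] by simp
  also have "\<dots> = (((f \<otimes>\<^sub>m Id C U) \<otimes>\<^sub>m Id C V) \<cdot> coev X) \<cdot> RUnit C X"
    by (simp add: coev_def)
  finally show "(coev Y \<cdot> f) \<cdot> RUnit C X = (((f \<otimes>\<^sub>m Id C U) \<otimes>\<^sub>m Id C V) \<cdot> coev X) \<cdot> RUnit C X" .
qed (use f in \<open>auto simp: Hom_iff dual_simps coev_typing\<close>)

lemma ev_natural:
  assumes f: "f \<in> Hom C X Y"
  shows "ev Y \<cdot> ((f \<otimes>\<^sub>m Id C V) \<otimes>\<^sub>m Id C U) = f \<cdot> ev X"
proof -
  have [simp]: "f \<in> Mor C" "Dom C f = X" "Cod C f = Y" "X \<in> Obj C" "Y \<in> Obj C"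
    using f by (auto simp: Hom_iff cat_simps)
  note [simp] = dual_simps
  have "ev Y \<cdot> ((f \<otimes>\<^sub>m Id C V) \<otimes>\<^sub>m Id C U)
      = RUnit C Y \<cdot> (Id C Y \<otimes>\<^sub>m d) \<cdot> (f \<otimes>\<^sub>m Id C (V \<otimes>\<^sub>o U)) \<cdot> minv C (Assoc C X V U)"
    using minv_Assoc_natural[of f "Id C V" "Id C U"] by (simp add: ev_def)
  also have "\<dots> = RUnit C Y \<cdot> (f \<otimes>\<^sub>m Id C \<I>) \<cdot> (Id C X \<otimes>\<^sub>m d) \<cdot> minv C (Assoc C X V U)"
    by (simp add: interchange Comp_rewrite[OF interchange])
  also have "\<dots> = f \<cdot> ev X"
    by (simp add: ev_def Comp_rewrite[OF RUnit_natural[OF f]])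
  finally show ?thesis .
qed

text \<open>For \<open>U = B\<close>, \<open>V = B\<^sup>*\<close>, \<open>Y = A\<close> and \<open>W = A\<^sup>*\<close> the right-hand side is the
  multiplication \<open>m\<^bsub>A,B,A\<^esub>\<close>.\<close>

lemma ev_TMor_Id:
  assumes [simp]: "Y \<in> Obj C" "W \<in> Obj C"
  shows "(ev Y \<otimes>\<^sub>m Id C W) \<cdot> Assoc C (Y \<otimes>\<^sub>o V) U W =
    (Id C Y \<otimes>\<^sub>m LUnit C W) \<cdot> (Id C Y \<otimes>\<^sub>m (d \<otimes>\<^sub>m Id C W)) \<cdot> (Id C Y \<otimes>\<^sub>m Assoc C V U W) \<cdot>
      minv C (Assoc C Y V (U \<otimes>\<^sub>o W))"
proof (rule iso_cancel_right[of "Assoc C Y V (U \<otimes>\<^sub>o W)"])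
  note [simp] = dual_simps
  let ?W = "Id C W"
  \<comment> \<open>The extra associator completes one side of the pentagon for
    \<open>Y, V, U, W\<close> and cancels the inverse on the right-hand side.\<close>
  have "(ev Y \<otimes>\<^sub>m ?W) \<cdot> Assoc C (Y \<otimes>\<^sub>o V) U W \<cdot> Assoc C Y V (U \<otimes>\<^sub>o W)
      = (ev Y \<otimes>\<^sub>m ?W) \<cdot> (Assoc C Y V U \<otimes>\<^sub>m ?W) \<cdot>
        Assoc C Y (V \<otimes>\<^sub>o U) W \<cdot> (Id C Y \<otimes>\<^sub>m Assoc C V U W)"
    by (simp add: pentagon)
  also have "\<dots> = ((RUnit C Y \<cdot> (Id C Y \<otimes>\<^sub>m d)) \<otimes>\<^sub>m ?W) \<cdot>
        Assoc C Y (V \<otimes>\<^sub>o U) W \<cdot> (Id C Y \<otimes>\<^sub>m Assoc C V U W)"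
    by (subst Comp_rewrite[OF interchange]) (simp_all add: ev_typing, simp add: ev_def)
  also have "\<dots> = (RUnit C Y \<otimes>\<^sub>m ?W) \<cdot> ((Id C Y \<otimes>\<^sub>m d) \<otimes>\<^sub>m ?W) \<cdot>
        Assoc C Y (V \<otimes>\<^sub>o U) W \<cdot> (Id C Y \<otimes>\<^sub>m Assoc C V U W)"
    by (simp add: Comp_rewrite[OF interchange])
  also have "\<dots> = (RUnit C Y \<otimes>\<^sub>m ?W) \<cdot> Assoc C Y \<I> W \<cdot> (Id C Y \<otimes>\<^sub>m (d \<otimes>\<^sub>m ?W)) \<cdot>
        (Id C Y \<otimes>\<^sub>m Assoc C V U W)"
    using Comp_rewrite[OF Assoc_natural'[of "Id C Y" d ?W], of "Id C Y \<otimes>\<^sub>m Assoc C V U W"] by simp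
  also have "\<dots> = (Id C Y \<otimes>\<^sub>m LUnit C W) \<cdot> (Id C Y \<otimes>\<^sub>m (d \<otimes>\<^sub>m ?W)) \<cdot> (Id C Y \<otimes>\<^sub>m Assoc C V U W)"
    by (simp add: Comp_rewrite[OF triangle])
  finally show "((ev Y \<otimes>\<^sub>m ?W) \<cdot> Assoc C (Y \<otimes>\<^sub>o V) U W) \<cdot> Assoc C Y V (U \<otimes>\<^sub>o W) =
    ((Id C Y \<otimes>\<^sub>m LUnit C W) \<cdot> (Id C Y \<otimes>\<^sub>m (d \<otimes>\<^sub>m Id C W)) \<cdot> (Id C Y \<otimes>\<^sub>m Assoc C V U W) \<cdot>
      minv C (Assoc C Y V (U \<otimes>\<^sub>o W))) \<cdot> Assoc C Y V (U \<otimes>\<^sub>o W)"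
    by (simp add: ev_typing)
qed (simp_all add: dual_simps ev_typing)

text \<open>A triangle identity of the adjunction: it is the first zigzag identity of the dual
  tensored with \<open>X\<close> on the left. Kelly's identity turns the right unit of
  \<open>X \<otimes>\<^sub>o U\<close> into that of \<open>U\<close>.\<close>

lemma ev_coev:
  assumes [simp]: "X \<in> Obj C"
  shows "ev (X \<otimes>\<^sub>o U) \<cdot> (coev X \<otimes>\<^sub>m Id C U) = Id C (X \<otimes>\<^sub>o U)"
proof (rule iso_cancel_right[of "RUnit C X \<otimes>\<^sub>m Id C U"])
  note [simp] = dual_simps
  let ?X = "Id C X" and ?U = "Id C U"
  \<comment> \<open>The pentagon for \<open>X, U, V, U\<close> with two of its associators
    inverted.\<close>
  have *: "minv C (Assoc C (X \<otimes>\<^sub>o U) V U) \<cdot> (Assoc C X U V \<otimes>\<^sub>m ?U) \<cdot> Assoc C X (U \<otimes>\<^sub>o V) U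
      = Assoc C X U (V \<otimes>\<^sub>o U) \<cdot> (?X \<otimes>\<^sub>m minv C (Assoc C U V U))"
  proof (rule iso_cancel_right[of "?X \<otimes>\<^sub>m Assoc C U V U"])
    have "minv C (Assoc C (X \<otimes>\<^sub>o U) V U) \<cdot> Assoc C (X \<otimes>\<^sub>o U) V U \<cdot> Assoc C X U (V \<otimes>\<^sub>o U)
        = Assoc C X U (V \<otimes>\<^sub>o U)"
      by (subst Comp_rewrite[OF minv_Comp]) simp_all
    then show "(minv C (Assoc C (X \<otimes>\<^sub>o U) V U) \<cdot> (Assoc C X U V \<otimes>\<^sub>m ?U) \<cdot> Assoc C X (U \<otimes>\<^sub>o V) U) \<cdot>
        (?X \<otimes>\<^sub>m Assoc C U V U) =
        (Assoc C X U (V \<otimes>\<^sub>o U) \<cdot> (?X \<otimes>\<^sub>m minv C (Assoc C U V U))) \<cdot> (?X \<otimes>\<^sub>m Assoc C U V U)"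
      by (simp add: pentagon interchange)
  qed (simp_all add: iso_mor_TMor iso_mor_Id)
  \<comment> \<open>Freed of the inverse of \<lambda>, the zigzag identity ends in \<lambda>, which
    the triangle can absorb.\<close>
  have zigzag: "RUnit C U \<cdot> (?U \<otimes>\<^sub>m d) \<cdot> minv C (Assoc C U V U) \<cdot> (b \<otimes>\<^sub>m ?U) = LUnit C U"
  proof (rule iso_cancel_right[of "minv C (LUnit C U)"])
    show "(RUnit C U \<cdot> (?U \<otimes>\<^sub>m d) \<cdot> minv C (Assoc C U V U) \<cdot> (b \<otimes>\<^sub>m ?U)) \<cdot> minv C (LUnit C U)
        = LUnit C U \<cdot> minv C (LUnit C U)"
      using dual by (simp add: right_dual_def)
    show "iso_mor C (minv C (LUnit C U))"
      unfolding iso_mor_def inverse_mor_def by (rule exI[of _ "LUnit C U"]) (simp add: Hom_iff)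
  qed simp_all
  have "(coev X \<otimes>\<^sub>m ?U) \<cdot> (RUnit C X \<otimes>\<^sub>m ?U) = (Assoc C X U V \<otimes>\<^sub>m ?U) \<cdot> ((?X \<otimes>\<^sub>m b) \<otimes>\<^sub>m ?U)"
    by (simp add: interchange coev_typing) (simp add: coev_def)
  \<comment> \<open>The trailing associator is carried along because the triangle equates
    \<open>(RUnit C X \<otimes>\<^sub>m ?U) \<cdot> Assoc C X \<I> U\<close> with
    \<open>?X \<otimes>\<^sub>m LUnit C U\<close>.\<close>
  then have "(ev (X \<otimes>\<^sub>o U) \<cdot> (coev X \<otimes>\<^sub>m ?U)) \<cdot> (RUnit C X \<otimes>\<^sub>m ?U) \<cdot> Assoc C X \<I> U
      = ev (X \<otimes>\<^sub>o U) \<cdot> (Assoc C X U V \<otimes>\<^sub>m ?U) \<cdot> ((?X \<otimes>\<^sub>m b) \<otimes>\<^sub>m ?U) \<cdot> Assoc C X \<I> U"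
    using Comp_rewrite[of "coev X \<otimes>\<^sub>m ?U" "RUnit C X \<otimes>\<^sub>m ?U" _ "Assoc C X \<I> U"]
    by (simp add: coev_typing ev_typing)
  also have "\<dots> = ev (X \<otimes>\<^sub>o U) \<cdot> (Assoc C X U V \<otimes>\<^sub>m ?U) \<cdot> Assoc C X (U \<otimes>\<^sub>o V) U \<cdot> (?X \<otimes>\<^sub>m (b \<otimes>\<^sub>m ?U))"
    using Assoc_natural'[of ?X b ?U] by simp
  also have "\<dots> = RUnit C (X \<otimes>\<^sub>o U) \<cdot> (Id C (X \<otimes>\<^sub>o U) \<otimes>\<^sub>m d) \<cdot>
      (minv C (Assoc C (X \<otimes>\<^sub>o U) V U) \<cdot> (Assoc C X U V \<otimes>\<^sub>m ?U) \<cdot> Assoc C X (U \<otimes>\<^sub>o V) U) \<cdot>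
      (?X \<otimes>\<^sub>m (b \<otimes>\<^sub>m ?U))"
    by (simp add: ev_def)
  also have "\<dots> = RUnit C (X \<otimes>\<^sub>o U) \<cdot> ((Id C (X \<otimes>\<^sub>o U) \<otimes>\<^sub>m d) \<cdot> Assoc C X U (V \<otimes>\<^sub>o U)) \<cdot>
      (?X \<otimes>\<^sub>m minv C (Assoc C U V U)) \<cdot> (?X \<otimes>\<^sub>m (b \<otimes>\<^sub>m ?U))"
    unfolding * by simp
  also have "\<dots> = (RUnit C (X \<otimes>\<^sub>o U) \<cdot> Assoc C X U \<I>) \<cdot> (?X \<otimes>\<^sub>m ?U \<otimes>\<^sub>m d) \<cdot>
      (?X \<otimes>\<^sub>m minv C (Assoc C U V U)) \<cdot> (?X \<otimes>\<^sub>m (b \<otimes>\<^sub>m ?U))"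
    using Assoc_natural'[of ?X ?U d, symmetric] by simp
  also have "\<dots> = ?X \<otimes>\<^sub>m (RUnit C U \<cdot> (?U \<otimes>\<^sub>m d) \<cdot> minv C (Assoc C U V U) \<cdot> (b \<otimes>\<^sub>m ?U))"
    unfolding RUnit_TObj[OF assms dual_typing(1)] by (simp add: interchange)
  also have "\<dots> = (Id C (X \<otimes>\<^sub>o U) \<cdot> (RUnit C X \<otimes>\<^sub>m ?U)) \<cdot> Assoc C X \<I> U"
    unfolding zigzag by (simp add: triangle)
  finally show "(ev (X \<otimes>\<^sub>o U) \<cdot> (coev X \<otimes>\<^sub>m ?U)) \<cdot> (RUnit C X \<otimes>\<^sub>m ?U) =
      Id C (X \<otimes>\<^sub>o U) \<cdot> (RUnit C X \<otimes>\<^sub>m ?U)"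
    by - (rule iso_cancel_right[of "Assoc C X \<I> U"], simp_all add: coev_typing ev_typing)
qed (simp_all add: dual_simps coev_typing ev_typing iso_mor_TMor iso_mor_Id)

text \<open>The other triangle identity, from the second zigzag identity tensored with
  \<open>Y\<close> on the left; \<open>ev_TMor_Id\<close> has already absorbed the pentagon.\<close>

lemma coev_ev:
  assumes [simp]: "Y \<in> Obj C"
  shows "(ev Y \<otimes>\<^sub>m Id C V) \<cdot> coev (Y \<otimes>\<^sub>o V) = Id C (Y \<otimes>\<^sub>o V)"
proof (rule iso_cancel_right[of "RUnit C (Y \<otimes>\<^sub>o V)"])
  note [simp] = dual_simps
  let ?Y = "Id C Y" and ?V = "Id C V"
  have zigzag: "LUnit C V \<cdot> (d \<otimes>\<^sub>m ?V) \<cdot> Assoc C V U V \<cdot> (?V \<otimes>\<^sub>m b) = RUnit C V"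
  proof (rule iso_cancel_right[of "minv C (RUnit C V)"])
    show "(LUnit C V \<cdot> (d \<otimes>\<^sub>m ?V) \<cdot> Assoc C V U V \<cdot> (?V \<otimes>\<^sub>m b)) \<cdot> minv C (RUnit C V)
        = RUnit C V \<cdot> minv C (RUnit C V)"
      using dual by (simp add: right_dual_def)
    show "iso_mor C (minv C (RUnit C V))"
      unfolding iso_mor_def inverse_mor_def by (rule exI[of _ "RUnit C V"]) (simp add: Hom_iff)
  qed simp_all
  have "((ev Y \<otimes>\<^sub>m ?V) \<cdot> coev (Y \<otimes>\<^sub>o V)) \<cdot> RUnit C (Y \<otimes>\<^sub>o V) \<cdot> Assoc C Y V \<I>
      = ((ev Y \<otimes>\<^sub>m ?V) \<cdot> Assoc C (Y \<otimes>\<^sub>o V) U V) \<cdot> (Id C (Y \<otimes>\<^sub>o V) \<otimes>\<^sub>m b) \<cdot> Assoc C Y V \<I>"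
    using Comp_rewrite[OF minv_Comp[of "RUnit C (Y \<otimes>\<^sub>o V)"], of "Assoc C Y V \<I>"]
    by (simp add: coev_def ev_typing)
  also have "\<dots> = ((ev Y \<otimes>\<^sub>m ?V) \<cdot> Assoc C (Y \<otimes>\<^sub>o V) U V) \<cdot> Assoc C Y V (U \<otimes>\<^sub>o V) \<cdot> (?Y \<otimes>\<^sub>m ?V \<otimes>\<^sub>m b)"
    using Assoc_natural'[of ?Y ?V b] by simp
  also have "\<dots> = (?Y \<otimes>\<^sub>m LUnit C V) \<cdot> (?Y \<otimes>\<^sub>m (d \<otimes>\<^sub>m ?V)) \<cdot> (?Y \<otimes>\<^sub>m Assoc C V U V) \<cdot> (?Y \<otimes>\<^sub>m ?V \<otimes>\<^sub>m b)"
    unfolding ev_TMor_Id[OF assms dual_typing(2)]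
    using Comp_rewrite[OF minv_Comp[of "Assoc C Y V (U \<otimes>\<^sub>o V)"], of "?Y \<otimes>\<^sub>m ?V \<otimes>\<^sub>m b"] by simp
  also have "\<dots> = ?Y \<otimes>\<^sub>m (LUnit C V \<cdot> (d \<otimes>\<^sub>m ?V) \<cdot> Assoc C V U V \<cdot> (?V \<otimes>\<^sub>m b))"
    by (simp add: interchange)
  also have "\<dots> = (Id C (Y \<otimes>\<^sub>o V) \<cdot> RUnit C (Y \<otimes>\<^sub>o V)) \<cdot> Assoc C Y V \<I>"
    unfolding zigzag by (simp add: RUnit_TObj)
  finally show "((ev Y \<otimes>\<^sub>m ?V) \<cdot> coev (Y \<otimes>\<^sub>o V)) \<cdot> RUnit C (Y \<otimes>\<^sub>o V) =
      Id C (Y \<otimes>\<^sub>o V) \<cdot> RUnit C (Y \<otimes>\<^sub>o V)"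
    by - (rule iso_cancel_right[of "Assoc C Y V \<I>"], simp_all add: coev_typing ev_typing)
qed (simp_all add: dual_simps coev_typing ev_typing)

text \<open>Naturality of the unit moves \<open>g\<close> to the right, and what remains is the
  triangle identity \<open>coev_ev\<close>. The opposite composite uses naturality of the counit and
  \<open>ev_coev\<close>.\<close>

lemma curry_uncurry:
  assumes "Y \<in> Obj C" "g \<in> Hom C X (Y \<otimes>\<^sub>o V)"
  shows "curry_mor X (uncurry_mor Y g) = g"
proof -
  have [simp]: "g \<in> Mor C" "Dom C g = X" "Cod C g = Y \<otimes>\<^sub>o V" "X \<in> Obj C" "Y \<in> Obj C"
    using assms by (auto simp: Hom_iff cat_simps)
  note [simp] = dual_simps coev_typing ev_typing
  have "curry_mor X (uncurry_mor Y g)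
      = (ev Y \<otimes>\<^sub>m Id C V) \<cdot> ((g \<otimes>\<^sub>m Id C U) \<otimes>\<^sub>m Id C V) \<cdot> coev X"
    by (simp add: curry_mor_def uncurry_mor_def Comp_rewrite[OF interchange])
  also have "\<dots> = ((ev Y \<otimes>\<^sub>m Id C V) \<cdot> coev (Y \<otimes>\<^sub>o V)) \<cdot> g"
    by (simp add: coev_natural[OF assms(2), symmetric])
  finally show ?thesis
    by (simp add: coev_ev)
qed

lemma uncurry_curry:
  assumes "X \<in> Obj C" "f \<in> Hom C (X \<otimes>\<^sub>o U) Y"
  shows "uncurry_mor Y (curry_mor X f) = f"
proof -
  have [simp]: "f \<in> Mor C" "Dom C f = X \<otimes>\<^sub>o U" "Cod C f = Y" "X \<in> Obj C" "Y \<in> Obj C"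
    using assms by (auto simp: Hom_iff cat_simps)
  note [simp] = dual_simps coev_typing ev_typing
  have "uncurry_mor Y (curry_mor X f)
      = (ev Y \<cdot> ((f \<otimes>\<^sub>m Id C V) \<otimes>\<^sub>m Id C U)) \<cdot> (coev X \<otimes>\<^sub>m Id C U)"
    by (simp add: curry_mor_def uncurry_mor_def interchange)
  also have "\<dots> = f \<cdot> ev (X \<otimes>\<^sub>o U) \<cdot> (coev X \<otimes>\<^sub>m Id C U)"
    unfolding ev_natural[OF assms(2)] by simp
  finally show ?thesis
    by (simp add: ev_coev)
qed

lemma curry_Hom: "X \<in> Obj C \<Longrightarrow> f \<in> Hom C (X \<otimes>\<^sub>o U) Y \<Longrightarrow> curry_mor X f \<in> Hom C X (Y \<otimes>\<^sub>o V)"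
  by (auto simp: Hom_iff curry_mor_def dual_simps coev_typing)

lemma uncurry_Hom: "Y \<in> Obj C \<Longrightarrow> g \<in> Hom C X (Y \<otimes>\<^sub>o V) \<Longrightarrow> uncurry_mor Y g \<in> Hom C (X \<otimes>\<^sub>o U) Y"
  by (auto simp: Hom_iff uncurry_mor_def dual_simps ev_typing)

lemma bij_betw_curry:
  "X \<in> Obj C \<Longrightarrow> Y \<in> Obj C \<Longrightarrow> bij_betw (curry_mor X) (Hom C (X \<otimes>\<^sub>o U) Y) (Hom C X (Y \<otimes>\<^sub>o V))"
  by (rule bij_betwI[where g = "uncurry_mor Y"])
    (auto simp: curry_Hom uncurry_Hom curry_uncurry uncurry_curry)

lemma bij_betw_uncurry:
  "X \<in> Obj C \<Longrightarrow> Y \<in> Obj C \<Longrightarrow> bij_betw (uncurry_mor Y) (Hom C X (Y \<otimes>\<^sub>o V)) (Hom C (X \<otimes>\<^sub>o U) Y)"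
  by (rule bij_betwI[where g = "curry_mor X"])
    (auto simp: curry_Hom uncurry_Hom curry_uncurry uncurry_curry)

lemma internal_hom_curry:
  assumes "Y \<in> Obj C"
  shows "internal_hom C U Y (Y \<otimes>\<^sub>o V) curry_mor"
proof -
  have "curry_mor X' (p \<cdot> (f \<otimes>\<^sub>m Id C U)) = curry_mor X p \<cdot> f"
    if "f \<in> Hom C X' X" "p \<in> Hom C (X \<otimes>\<^sub>o U) Y" for X X' f p
  proof -
    have [simp]: "f \<in> Mor C" "Dom C f = X'" "Cod C f = X" "X \<in> Obj C" "X' \<in> Obj C"
      "p \<in> Mor C" "Dom C p = X \<otimes>\<^sub>o U" "Cod C p = Y"
      using that by (auto simp: Hom_iff cat_simps)
    note [simp] = dual_simps coev_typing
    have "curry_mor X' (p \<cdot> (f \<otimes>\<^sub>m Id C U))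
        = (p \<otimes>\<^sub>m Id C V) \<cdot> ((f \<otimes>\<^sub>m Id C U) \<otimes>\<^sub>m Id C V) \<cdot> coev X'"
      by (simp add: curry_mor_def Comp_rewrite[OF interchange])
    also have "\<dots> = curry_mor X p \<cdot> f"
      by (simp add: curry_mor_def coev_natural[OF that(1)])
    finally show ?thesis .
  qed
  with assms show ?thesis
    by (simp add: internal_hom_def bij_betw_curry dual_simps)
qed

text \<open>\<open>- \<otimes> V\<close> is a right adjoint.\<close>

lemma monic_TMor_Id:
  assumes m: "monic C m"
  shows "monic C (m \<otimes>\<^sub>m Id C V)"
proof -
  have [simp]: "m \<in> Mor C"
    using m by (simp add: monic_def)
  note [simp] = dual_simps ev_typing
  have "f = g"
    if f: "f \<in> Hom C W (Dom C m \<otimes>\<^sub>o V)" and g: "g \<in> Hom C W (Dom C m \<otimes>\<^sub>o V)"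
      and eq: "(m \<otimes>\<^sub>m Id C V) \<cdot> f = (m \<otimes>\<^sub>m Id C V) \<cdot> g" for W f g
  proof -
    \<comment> \<open>By naturality of the counit, transposing a composite with
      \<open>m \<otimes>\<^sub>m Id C V\<close> gives a composite with \<open>m\<close>, where
      monicity is available.\<close>
    have uncurry: "m \<cdot> uncurry_mor (Dom C m) h = uncurry_mor (Cod C m) ((m \<otimes>\<^sub>m Id C V) \<cdot> h)"
      if "h \<in> Hom C W (Dom C m \<otimes>\<^sub>o V)" for h
    proof -
      have [simp]: "h \<in> Mor C" "Dom C h = W" "Cod C h = Dom C m \<otimes>\<^sub>o V" "W \<in> Obj C"
        using that by (auto simp: Hom_iff cat_simps)
      have "m \<cdot> ev (Dom C m) \<cdot> (h \<otimes>\<^sub>m Id C U)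
          = (ev (Cod C m) \<cdot> ((m \<otimes>\<^sub>m Id C V) \<otimes>\<^sub>m Id C U)) \<cdot> (h \<otimes>\<^sub>m Id C U)"
        using ev_natural[of m "Dom C m" "Cod C m"] by (simp add: Hom_iff)
      then show ?thesis
        by (simp add: uncurry_mor_def interchange)
    qed
    have "m \<cdot> uncurry_mor (Dom C m) f = m \<cdot> uncurry_mor (Dom C m) g"
      using uncurry f g eq by simp
    then have "uncurry_mor (Dom C m) f = uncurry_mor (Dom C m) g"
      using m uncurry_Hom[OF _ f] uncurry_Hom[OF _ g] Dom_Obj[OF \<open>m \<in> Mor C\<close>]
      unfolding monic_def by blast
    then show ?thesis
      using curry_uncurry f g by (metis Dom_Obj \<open>m \<in> Mor C\<close>)
  qed
  then show ?thesis
    by (simp add: monic_def)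
qed

end

text \<open>Interchanging the objects exchanges the two identities, so the adjunction for right
  duals also covers the left coevaluations.\<close>

lemma (in tensor_category) left_dual_iff_right_dual:
  "left_dual C U V b d \<longleftrightarrow> right_dual C V U b d"
  by (auto simp: left_dual_def right_dual_def)


section \<open>Condition C\<close>

context condition_C
begin

lemma SPair_whisker:
  assumes "f \<in> Hom C X U" "V \<in> Obj C" "p \<in> Hom C U (V\<^sup>\<star>)"
  shows "SPair C X V (p \<cdot> f) = SPair C U V p \<cdot> (f \<otimes>\<^sub>m Id C V)"
proof -
  have "SPair C X V (SMor C (Id C V) \<cdot> p \<cdot> f) = SPair C U V p \<cdot> (f \<otimes>\<^sub>m Id C V)"
    by (rule SPair_natural) (use assms Id_Hom in auto)
  then show ?thesis
    using assms by (simp add: SMor_Id Hom_iff cat_simps SObj_Obj)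
qed

text \<open>With \<open>q\<close> the preimage of \<open>p\<close> under \<pi>, naturality makes
  \<open>f \<mapsto> p \<cdot> (f \<otimes>\<^sub>m Id C V)\<close> the composite of
  \<open>f \<mapsto> q \<cdot> f\<close> with the bijection \<pi>. Hence composition with
  \<open>q\<close> is bijective on every hom-set into \<open>U\<close>, and Yoneda applies.\<close>

lemma nondegenerate_if_bij_betw:
  assumes U: "U \<in> Obj C" and V: "V \<in> Obj C" and p: "p \<in> Hom C (U \<otimes>\<^sub>o V) (\<I>\<^sup>\<star>)"
    and bij: "\<And>X. X \<in> Obj C \<Longrightarrow>
      bij_betw (\<lambda>f. p \<cdot> (f \<otimes>\<^sub>m Id C V)) (Hom C X U) (Hom C (X \<otimes>\<^sub>o V) (\<I>\<^sup>\<star>))"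
  shows "nondegenerate C U V p"
proof -
  define q where "q = inv_into (Hom C U (V\<^sup>\<star>)) (SPair C U V) p"
  have q: "q \<in> Hom C U (V\<^sup>\<star>)" and Pq: "SPair C U V q = p"
    using SPair_bij[OF U V] p unfolding q_def
    by (auto simp: bij_betw_def inv_into_into f_inv_into_f)
  have "bij_betw (\<lambda>f. q \<cdot> f) (Hom C X U) (Hom C X (V\<^sup>\<star>))" if X: "X \<in> Obj C" for X
  proof -
    have "bij_betw (SPair C X V \<circ> (\<lambda>f. q \<cdot> f)) (Hom C X U) (Hom C (X \<otimes>\<^sub>o V) (\<I>\<^sup>\<star>))"
      by (rule iffD1[OF bij_betw_cong bij[OF X]]) (simp add: SPair_whisker[OF _ V q] Pq)
    moreover have "(\<lambda>f. q \<cdot> f) ` Hom C X U \<subseteq> Hom C X (V\<^sup>\<star>)"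
      using q by (auto intro: Comp_Hom)
    ultimately show ?thesis
      using bij_betw_comp_iff2[OF SPair_bij[OF X V]] by blast
  qed
  then have "iso_mor C q"
    by (rule iso_mor_if_bij_betw_Comp[OF q])
  with p show ?thesis
    by (simp add: nondegenerate_def q_def)
qed

text \<open>Transposing \<open>f : X \<rightarrow> A \<otimes> B\<^sup>*\<close> along the duality of \<open>B\<close> turns the pairing
  precomposed with \<open>f \<otimes> id\<close> into \<open>\<pi>\<close> of the transpose followed by \<open>\<delta>\<^sub>A\<close>.\<close>

lemma pairing_nondegenerate:
  assumes [simp]: "A \<in> Obj C" and dual: "right_dual C B (B\<^sup>\<star>) b (d B)"
  shows "nondegenerate C (ihom C B A) (ihom C A B) (ihom_eps C A \<cdot> ihom_mult C d A B A)"
proof -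
  interpret right_dual_pair C B "B\<^sup>\<star>" b "d B"
    by unfold_locales (rule dual)
  note [simp] = dual_simps ev_typing SObj_Obj
  let ?P = "A \<otimes>\<^sub>o B\<^sup>\<star>" and ?Q = "B \<otimes>\<^sub>o A\<^sup>\<star>"
  have \<epsilon>_Hom: "ihom_eps C A \<in> Hom C (A \<otimes>\<^sub>o A\<^sup>\<star>) (\<I>\<^sup>\<star>)"
    using SPair_bij[of A "A\<^sup>\<star>"] SBidual_Hom[of A] by (auto simp: ihom_eps_def bij_betw_def)
  then have [simp]: "ihom_eps C A \<in> Mor C" "Dom C (ihom_eps C A) = A \<otimes>\<^sub>o A\<^sup>\<star>"
    "Cod C (ihom_eps C A) = \<I>\<^sup>\<star>"
    by (auto simp: Hom_iff)
  have mult: "ihom_mult C d A B A = (ev A \<otimes>\<^sub>m Id C (A\<^sup>\<star>)) \<cdot> Assoc C ?P B (A\<^sup>\<star>)"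
    by (simp add: ihom_mult_def ev_TMor_Id)
  have pairing: "(ihom_eps C A \<cdot> ihom_mult C d A B A) \<cdot> (f \<otimes>\<^sub>m Id C ?Q)
      = SPair C (X \<otimes>\<^sub>o B) (A\<^sup>\<star>) (SBidual C A \<cdot> uncurry_mor A f) \<cdot> Assoc C X B (A\<^sup>\<star>)"
    if f: "f \<in> Hom C X ?P" for X f
  proof -
    have [simp]: "f \<in> Mor C" "Dom C f = X" "Cod C f = ?P" "X \<in> Obj C"
      using f by (auto simp: Hom_iff cat_simps)
    have "(ihom_eps C A \<cdot> ihom_mult C d A B A) \<cdot> (f \<otimes>\<^sub>m Id C ?Q)
        = ihom_eps C A \<cdot> (ev A \<otimes>\<^sub>m Id C (A\<^sup>\<star>)) \<cdot> ((f \<otimes>\<^sub>m Id C B) \<otimes>\<^sub>m Id C (A\<^sup>\<star>)) \<cdot> Assoc C X B (A\<^sup>\<star>)"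
      using Assoc_natural'[of f "Id C B" "Id C (A\<^sup>\<star>)"] by (simp add: mult)
    also have "\<dots> = (ihom_eps C A \<cdot> (uncurry_mor A f \<otimes>\<^sub>m Id C (A\<^sup>\<star>))) \<cdot> Assoc C X B (A\<^sup>\<star>)"
      by (simp add: uncurry_mor_def Comp_rewrite[OF interchange])
    also have "ihom_eps C A \<cdot> (uncurry_mor A f \<otimes>\<^sub>m Id C (A\<^sup>\<star>))
        = SPair C (X \<otimes>\<^sub>o B) (A\<^sup>\<star>) (SBidual C A \<cdot> uncurry_mor A f)"
      unfolding ihom_eps_def
      by (rule SPair_whisker[symmetric]) (simp_all add: uncurry_Hom f SBidual_Hom)
    finally show ?thesis .
  qed
  show ?thesis
    unfolding ihom_def
  proof (rule nondegenerate_if_bij_betw)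
    show "ihom_eps C A \<cdot> ihom_mult C d A B A \<in> Hom C (?P \<otimes>\<^sub>o ?Q) (\<I>\<^sup>\<star>)"
      by (simp add: mult Hom_iff)
    fix X assume X [simp]: "X \<in> Obj C"
    have \<delta>: "bij_betw (\<lambda>f. SBidual C A \<cdot> f) (Hom C (X \<otimes>\<^sub>o B) A) (Hom C (X \<otimes>\<^sub>o B) ((A\<^sup>\<star>)\<^sup>\<star>))"
      using bij_betw_Comp_iso(1)[OF SBidual_iso[of A]] SBidual_Hom[of A] by (simp add: Hom_iff)
    have \<alpha>: "bij_betw (\<lambda>f. f \<cdot> Assoc C X B (A\<^sup>\<star>)) (Hom C ((X \<otimes>\<^sub>o B) \<otimes>\<^sub>o A\<^sup>\<star>) (\<I>\<^sup>\<star>))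
        (Hom C (X \<otimes>\<^sub>o ?Q) (\<I>\<^sup>\<star>))"
      using bij_betw_Comp_iso(2)[of "Assoc C X B (A\<^sup>\<star>)"] by simp
    \<comment> \<open>Innermost first: transposition along the duality of \<open>B\<close>,
      composition with \<delta>, the bijection \<pi>, and reassociation.\<close>
    have "bij_betw ((\<lambda>f. f \<cdot> Assoc C X B (A\<^sup>\<star>)) \<circ> (SPair C (X \<otimes>\<^sub>o B) (A\<^sup>\<star>) \<circ>
        ((\<lambda>f. SBidual C A \<cdot> f) \<circ> uncurry_mor A))) (Hom C X ?P) (Hom C (X \<otimes>\<^sub>o ?Q) (\<I>\<^sup>\<star>))"
      by (intro bij_betw_trans[OF _ \<alpha>] bij_betw_trans[OF _ SPair_bij] bij_betw_trans[OF _ \<delta>]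
          bij_betw_uncurry) simp_all
    then show "bij_betw (\<lambda>f. (ihom_eps C A \<cdot> ihom_mult C d A B A) \<cdot> (f \<otimes>\<^sub>m Id C ?Q))
        (Hom C X ?P) (Hom C (X \<otimes>\<^sub>o ?Q) (\<I>\<^sup>\<star>))"
      by (rule iffD1[OF bij_betw_cong, rotated]) (simp add: pairing)
  qed simp_all
qed

text \<open>Condition C is essential here: with the direct sum as tensor product, the unit object is zero in
  a non-zero abelian tensor category.\<close>

lemma all_zero_if_Unit_subterminal:
  assumes zero: "zero_object C Z"
    and sub: "\<And>Y f g. f \<in> Hom C Y \<I> \<Longrightarrow> g \<in> Hom C Y \<I> \<Longrightarrow> f = g"
    and W: "W \<in> Obj C"
  shows "zero_object C W"
proof -
  have Z: "Z \<in> Obj C" and from_Z: "\<And>X. X \<in> Obj C \<Longrightarrow> \<exists>!f. f \<in> Hom C Z X"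
    and to_Z: "\<And>X. X \<in> Obj C \<Longrightarrow> \<exists>!f. f \<in> Hom C X Z"
    using zero by (auto simp: zero_object_def)
  have Hom_nonempty: "\<exists>f. f \<in> Hom C X Y" if "X \<in> Obj C" "Y \<in> Obj C" for X Y
    using from_Z[OF that(2)] to_Z[OF that(1)] Comp_Hom by blast
  \<comment> \<open>The identity of \<open>\<I>\<close> factors through \<open>Z\<close>, by the
    assumption on maps into \<open>\<I>\<close>; maps out of \<open>\<I>\<close> therefore agree
    once they agree on the initial object \<open>Z\<close>.\<close>
  have from_Unit: "f = g" if f: "f \<in> Hom C \<I> X" and g: "g \<in> Hom C \<I> X" for X f g
  proof -
    obtain s t where s: "s \<in> Hom C \<I> Z" and t: "t \<in> Hom C Z \<I>"
      using from_Z to_Z Unit_Obj by blast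
    have ts: "t \<cdot> s = Id C \<I>"
      using sub Comp_Hom[OF s t] Id_Hom[OF Unit_Obj] by blast
    have X: "X \<in> Obj C"
      using f by (auto simp: Hom_iff cat_simps)
    have "f \<cdot> t = g \<cdot> t"
      using from_Z[OF X] Comp_Hom[OF t f] Comp_Hom[OF t g] by blast
    then have "f \<cdot> (t \<cdot> s) = g \<cdot> (t \<cdot> s)"
      using Comp_assoc[OF s t f] Comp_assoc[OF s t g] by simp
    then show ?thesis
      using f g by (simp add: ts Hom_iff cat_simps)
  qed
  \<comment> \<open>Via \<lambda> and \<pi>, maps from \<open>V\<close> to
    \<open>\<I>\<^sup>\<star>\<close> correspond to maps from \<open>\<I>\<close> to
    \<open>V\<^sup>\<star>\<close>, which agree by the previous step.\<close>
  have to_dual_unit: "f = g" if V: "V \<in> Obj C" and f: "f \<in> Hom C V (\<I>\<^sup>\<star>)" and g: "g \<in> Hom C V (\<I>\<^sup>\<star>)"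
    for V f g
  proof (rule iso_cancel_right[OF LUnit_iso[OF V]])
    have pre: "h \<cdot> LUnit C V \<in> SPair C \<I> V ` Hom C \<I> (V\<^sup>\<star>)" if "h \<in> Hom C V (\<I>\<^sup>\<star>)" for h
      using SPair_bij[OF Unit_Obj V] Comp_Hom[OF LUnit_Hom[OF V] that] by (simp add: bij_betw_def)
    obtain f' g' where "f' \<in> Hom C \<I> (V\<^sup>\<star>)" "g' \<in> Hom C \<I> (V\<^sup>\<star>)"
      and "f \<cdot> LUnit C V = SPair C \<I> V f'" "g \<cdot> LUnit C V = SPair C \<I> V g'"
      using pre[OF f] pre[OF g] by blast
    then show "f \<cdot> LUnit C V = g \<cdot> LUnit C V"
      using from_Unit[of f' "V\<^sup>\<star>" g'] by simp
  qed (use f g V in \<open>auto simp: Hom_iff tensor_simps\<close>)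
  \<comment> \<open>Via \<delta> and \<pi>, maps from \<open>X\<close> to \<open>Y\<close>
    correspond to maps from \<open>X \<otimes>\<^sub>o Y\<^sup>\<star>\<close> to
    \<open>\<I>\<^sup>\<star>\<close>.\<close>
  have Hom_eq: "f = g" if f: "f \<in> Hom C X Y" and g: "g \<in> Hom C X Y" for X Y f g
  proof (rule iso_cancel_left)
    have XY: "X \<in> Obj C" "Y \<in> Obj C"
      using f by (auto simp: Hom_iff cat_simps)
    note XY' = XY(1) SObj_Obj[OF XY(2)]
    show "iso_mor C (SBidual C Y)"
      using SBidual_iso XY by blast
    have h: "SBidual C Y \<cdot> f \<in> Hom C X ((Y\<^sup>\<star>)\<^sup>\<star>)" "SBidual C Y \<cdot> g \<in> Hom C X ((Y\<^sup>\<star>)\<^sup>\<star>)"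
      using Comp_Hom f g SBidual_Hom[OF XY(2)] by blast+
    then have "SPair C X (Y\<^sup>\<star>) (SBidual C Y \<cdot> f) = SPair C X (Y\<^sup>\<star>) (SBidual C Y \<cdot> g)"
      using SPair_bij[OF XY'] by (intro to_dual_unit[OF TObj_Obj[OF XY']]) (auto simp: bij_betw_def)
    then show "SBidual C Y \<cdot> f = SBidual C Y \<cdot> g"
      using SPair_bij[OF XY'] h by (auto simp: bij_betw_def dest: inj_onD)
    show "Cod C f = Dom C (SBidual C Y)" "Cod C g = Dom C (SBidual C Y)"
      using SBidual_Hom[OF XY(2)] f g by (auto simp: Hom_iff)
  qed (use f g in \<open>auto simp: Hom_iff\<close>)
  show ?thesis
    unfolding zero_object_def using W Hom_nonempty Hom_eq by blast
qed

text \<open>The two coevaluations embed \<open>\<I>\<close> into \<open>B\<^sup>* \<otimes> ((B \<otimes> A\<^sup>*) \<otimes> A)\<close>, up to associativity.\<close>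

lemma Unit_subterminal:
  assumes AA: "right_dual C A (A\<^sup>\<star>) b\<^sub>A d\<^sub>A" and AA': "right_dual C (A\<^sup>\<star>) A b d"
    and BB': "right_dual C (B\<^sup>\<star>) B b' d'" and mono: "monic C b" "monic C b'"
    and zero: "zero_object C (B \<otimes>\<^sub>o A\<^sup>\<star>)"
    and u: "u \<in> Hom C Y \<I>" and v: "v \<in> Hom C Y \<I>"
  shows "u = v"
proof -
  interpret A: right_dual_pair C A "A\<^sup>\<star>" b\<^sub>A d\<^sub>A
    by unfold_locales (rule AA)
  interpret A': right_dual_pair C "A\<^sup>\<star>" A b d
    by unfold_locales (rule AA')
  interpret B': right_dual_pair C "B\<^sup>\<star>" B b' d'
    by unfold_locales (rule BB')
  note [simp] = A'.dual_simps B'.dual_typing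
  have [simp]: "u \<in> Mor C" "v \<in> Mor C" "Dom C u = Y" "Dom C v = Y" "Cod C u = \<I>" "Cod C v = \<I>"
    "Y \<in> Obj C"
    using u v by (auto simp: Hom_iff cat_simps)
  let ?a = "Assoc C B (A\<^sup>\<star>) A" and ?s = "b \<cdot> u" and ?t = "b \<cdot> v"
  let ?B = "Id C B" and ?B' = "Id C (B\<^sup>\<star>)" and ?I = "Id C \<I>"
  \<comment> \<open>Transposition along the duality of \<open>A\<^sup>\<star>\<close> lands in maps
    from \<open>X \<otimes>\<^sub>o A\<^sup>\<star>\<close> to a zero object.\<close>
  have sub: "f = g"
    if f: "f \<in> Hom C X ((B \<otimes>\<^sub>o A\<^sup>\<star>) \<otimes>\<^sub>o A)" and g: "g \<in> Hom C X ((B \<otimes>\<^sub>o A\<^sup>\<star>) \<otimes>\<^sub>o A)" for X f g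
  proof -
    have [simp]: "X \<in> Obj C"
      using f by (auto simp: Hom_iff cat_simps)
    have "\<exists>!h. h \<in> Hom C (X \<otimes>\<^sub>o A\<^sup>\<star>) (B \<otimes>\<^sub>o A\<^sup>\<star>)"
      using zero by (simp add: zero_object_def)
    moreover have "A'.uncurry_mor (B \<otimes>\<^sub>o A\<^sup>\<star>) f \<in> Hom C (X \<otimes>\<^sub>o A\<^sup>\<star>) (B \<otimes>\<^sub>o A\<^sup>\<star>)"
      "A'.uncurry_mor (B \<otimes>\<^sub>o A\<^sup>\<star>) g \<in> Hom C (X \<otimes>\<^sub>o A\<^sup>\<star>) (B \<otimes>\<^sub>o A\<^sup>\<star>)"
      using A'.uncurry_Hom f g by simp_all
    ultimately have "A'.uncurry_mor (B \<otimes>\<^sub>o A\<^sup>\<star>) f = A'.uncurry_mor (B \<otimes>\<^sub>o A\<^sup>\<star>) g"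
      by blast
    then show ?thesis
      using A'.curry_uncurry f g TObj_Obj[OF B'.dual_typing(2) A'.dual_typing(1)] by metis
  qed
  have "?a \<cdot> (?B \<otimes>\<^sub>m ?s) = ?a \<cdot> (?B \<otimes>\<^sub>m ?t)"
    by (rule sub[of _ "B \<otimes>\<^sub>o Y"]) (simp_all add: Hom_iff)
  then have "?B \<otimes>\<^sub>m ?s = ?B \<otimes>\<^sub>m ?t"
    by - (rule iso_cancel_left[of ?a], simp_all)
  \<comment> \<open>Tensor with \<open>B\<^sup>\<star>\<close> on the left and reassociate, to make
    room for \<open>b'\<close>.\<close>
  then have "(Id C (B\<^sup>\<star> \<otimes>\<^sub>o B) \<otimes>\<^sub>m ?s) \<cdot> Assoc C (B\<^sup>\<star>) B Y
      = (Id C (B\<^sup>\<star> \<otimes>\<^sub>o B) \<otimes>\<^sub>m ?t) \<cdot> Assoc C (B\<^sup>\<star>) B Y"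
    using Assoc_natural'[of ?B' ?B ?s] Assoc_natural'[of ?B' ?B ?t] by simp
  then have "Id C (B\<^sup>\<star> \<otimes>\<^sub>o B) \<otimes>\<^sub>m ?s = Id C (B\<^sup>\<star> \<otimes>\<^sub>o B) \<otimes>\<^sub>m ?t"
    by - (rule iso_cancel_right[of "Assoc C (B\<^sup>\<star>) B Y"], simp_all)
  then have "(Id C (B\<^sup>\<star> \<otimes>\<^sub>o B) \<otimes>\<^sub>m ?s) \<cdot> (b' \<otimes>\<^sub>m Id C Y) = (Id C (B\<^sup>\<star> \<otimes>\<^sub>o B) \<otimes>\<^sub>m ?t) \<cdot> (b' \<otimes>\<^sub>m Id C Y)"
    by simp
  \<comment> \<open>Interchange brings \<open>b'\<close> to the outside, from where it can be
    cancelled.\<close>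
  then have "(b' \<otimes>\<^sub>m Id C (A\<^sup>\<star> \<otimes>\<^sub>o A)) \<cdot> (?I \<otimes>\<^sub>m ?s) = (b' \<otimes>\<^sub>m Id C (A\<^sup>\<star> \<otimes>\<^sub>o A)) \<cdot> (?I \<otimes>\<^sub>m ?t)"
    by (simp add: interchange)
  then have "Assoc C (B\<^sup>\<star> \<otimes>\<^sub>o B) (A\<^sup>\<star>) A \<cdot> (b' \<otimes>\<^sub>m Id C (A\<^sup>\<star> \<otimes>\<^sub>o A)) \<cdot> (?I \<otimes>\<^sub>m ?s)
      = Assoc C (B\<^sup>\<star> \<otimes>\<^sub>o B) (A\<^sup>\<star>) A \<cdot> (b' \<otimes>\<^sub>m Id C (A\<^sup>\<star> \<otimes>\<^sub>o A)) \<cdot> (?I \<otimes>\<^sub>m ?t)"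
    by simp
  then have "((b' \<otimes>\<^sub>m Id C (A\<^sup>\<star>)) \<otimes>\<^sub>m Id C A) \<cdot> Assoc C \<I> (A\<^sup>\<star>) A \<cdot> (?I \<otimes>\<^sub>m ?s)
      = ((b' \<otimes>\<^sub>m Id C (A\<^sup>\<star>)) \<otimes>\<^sub>m Id C A) \<cdot> Assoc C \<I> (A\<^sup>\<star>) A \<cdot> (?I \<otimes>\<^sub>m ?t)"
    using Comp_rewrite[OF Assoc_natural'[of b' "Id C (A\<^sup>\<star>)" "Id C A"], of "?I \<otimes>\<^sub>m ?s"]
      Comp_rewrite[OF Assoc_natural'[of b' "Id C (A\<^sup>\<star>)" "Id C A"], of "?I \<otimes>\<^sub>m ?t"] by simp
  \<comment> \<open>The rebracketing splits the tensor factor in two: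
    \<open>- \<otimes> A\<^sup>\<star>\<close> and \<open>- \<otimes> A\<close> are right adjoints
    by the two dualities of \<open>A\<close>, hence preserve monomorphisms.\<close>
  moreover have "monic C ((b' \<otimes>\<^sub>m Id C (A\<^sup>\<star>)) \<otimes>\<^sub>m Id C A)"
    using mono(2) A.monic_TMor_Id A'.monic_TMor_Id by blast
  ultimately have "Assoc C \<I> (A\<^sup>\<star>) A \<cdot> (?I \<otimes>\<^sub>m ?s) = Assoc C \<I> (A\<^sup>\<star>) A \<cdot> (?I \<otimes>\<^sub>m ?t)"
    by (auto simp: monic_def Hom_iff)
  then have "?I \<otimes>\<^sub>m ?s = ?I \<otimes>\<^sub>m ?t"
    by - (rule iso_cancel_left[of "Assoc C \<I> (A\<^sup>\<star>) A"], simp_all)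
  then have "?s \<cdot> LUnit C Y = ?t \<cdot> LUnit C Y"
    using LUnit_natural[of ?s Y "A\<^sup>\<star> \<otimes>\<^sub>o A"] LUnit_natural[of ?t Y "A\<^sup>\<star> \<otimes>\<^sub>o A"]
    by (simp add: Hom_iff)
  then have "?s = ?t"
    by - (rule iso_cancel_right[of "LUnit C Y"], simp_all)
  then show ?thesis
    using mono(1) u v by (simp add: monic_def)
qed

end

text \<open>Clause (i) presupposes a non-zero object: where all objects are zero, so is
  \<open>B \<otimes>\<^sub>o A\<^sup>\<star>\<close>.\<close>

theorem theorem3p10:
  fixes C :: "('o, 'm, 'x) star_data_scheme" (structure)
    and b d b' d' :: "'o \<Rightarrow> 'm"
    and A B :: 'o
  assumes "abelian_tensor_category C"
    and "condition_C C"
    and "chosen_dualities C b d b' d'"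
    and "A \<in> Cb C"
    and "B \<in> Cb C"
  shows "internal_hom C A B (B \<otimes>\<^sub>o A\<^sup>\<star>) (ihom_iso C b A)
    \<and> ((\<exists>X\<in>Obj C. \<not> zero_object C X) \<longrightarrow> \<not> zero_object C (B \<otimes>\<^sub>o A\<^sup>\<star>))
    \<and> (ihom_unit b A \<in> Hom C \<I> (ihom C A A) \<and> monic C (ihom_unit b A))
    \<and> nondegenerate C (ihom C B A) (ihom C A B) (ihom_eps C A \<cdot> ihom_mult C d A B A)"
proof -
  interpret abelian_tensor_category C by fact
  interpret condition_C C by fact
  have dualities: "right_dual C X (X\<^sup>\<star>) (b X) (d X)" "right_dual C (X\<^sup>\<star>) X (b' X) (d' X)"
    "monic C (b X)" "monic C (b' X)" if "X \<in> Cb C" for X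
    using assms(3) that by (auto simp: chosen_dualities_def b_duality_def left_dual_iff_right_dual)
  note dA = dualities[OF assms(4)] and dB = dualities[OF assms(5)]
  interpret A: right_dual_pair C A "A\<^sup>\<star>" "b A" "d A"
    by unfold_locales (rule dA(1))
  have Obj: "A \<in> Obj C" "B \<in> Obj C"
    using assms(4,5) by (auto simp: Cb_def)
  have "A.curry_mor = ihom_iso C b A"
    by (simp add: fun_eq_iff A.curry_mor_def A.coev_def ihom_iso_def)
  then have "internal_hom C A B (B \<otimes>\<^sub>o A\<^sup>\<star>) (ihom_iso C b A)"
    using A.internal_hom_curry[OF Obj(2)] by simp
  \<comment> \<open>The contrapositive of (i).\<close>
  moreover have "zero_object C X" if "zero_object C (B \<otimes>\<^sub>o A\<^sup>\<star>)" "X \<in> Obj C" for X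
    using all_zero_if_Unit_subterminal[OF that(1) _ that(2)]
      Unit_subterminal[OF dA(1,2) dB(2) dA(4) dB(4) that(1)] by blast
  moreover have "ihom_unit b A \<in> Hom C \<I> (ihom C A A)" "monic C (ihom_unit b A)"
    using A.dual_typing dA(3) by (simp_all add: ihom_unit_def ihom_def Hom_iff)
  moreover have "nondegenerate C (ihom C B A) (ihom C A B) (ihom_eps C A \<cdot> ihom_mult C d A B A)"
    by (rule pairing_nondegenerate[where d = d, OF Obj(1) dB(1)])
  ultimately show ?thesis
    by blast
qed

end
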